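(* Let $\varepsilon\in(0,1]$, let $\mathbf u\colon\mathbb T^d\times(0,\infty)\to\mathbb R^n$ solve the Allen--Cahn system with parameter $\varepsilon$, let $y\in\mathbb T^d$ and $s>0$, and let $\rho_{(y,s)}$ denote the inverse heat kernel $$\rho_{(y,s)}(x,t)=\frac1{(4\pi(s-t))^{\frac{d-1}2}}\exp\Big(-\frac{|x-y|^2}{4(s-t)}\Big).$$ Then, identifying $\omega^\varepsilon_t$ and $\xi^\varepsilon_t$ with their periodic extensions to $\mathbb R^d$, we have $$\frac{d}{dt}\int_{\mathbb R^d}\rho_{(y,s)}(x,t)\,d\omega^\varepsilon_t(x)\le\frac1{2(s-t)}\int_{\mathbb R^d}\rho_{(y,s)}(x,t)\,d\xi^\varepsilon_t(x)$$ for any $t\in(0,s)$. Hence, decomposing $\xi^\varepsilon_t=\xi^\varepsilon_{t,+}-\xi^\varepsilon_{t,-}$ into its positive and negative part, $$\frac{d}{dt}\int_{\mathbb R^d}\rho_{(y,s)}(x,t)\,d\omega^\varepsilon_t(x)+\frac1{2(s-t)}\int_{\mathbb R^d}\rho_{(y,s)}(x,t)\,d\xi^\varepsilon_{t,-}(x)\le\frac1{2(s-t)}\int_{\mathbb R^d}\rho_{(y,s)}(x,t)\,d\xi^\varepsilon_{t,+}(x).$$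
   Context: Fix positive integers $d,n$ and $\alpha\in(0,1)$. $\mathbb T^d$ is the flat torus ($[0,1)^d$ with periodic boundary conditions). $W(u)=u^2(1-u)^2$, $\phi(u)=\int_0^u\sqrt{2W(s)}\,ds$, $\sigma=\phi(1)$, $$F_\varepsilon(\mathbf u)=\frac1\varepsilon\sum_{i=1}^nW(u_i)+\frac1{2\varepsilon^\alpha}\Big(\sigma-\sum_{i=1}^n\phi(u_i)\Big)^2,\qquad\mathbf u\in\mathbb R^n.$$ The Allen--Cahn system with parameter $\varepsilon$ is, for $1\le i\le n$, $$\varepsilon\partial_tu_i=\varepsilon\Delta u_i-\frac1\varepsilon W'(u_i)+\frac1{\varepsilon^\alpha}\sqrt{2W(u_i)}\Big(\sigma-\sum_{j=1}^n\phi(u_j)\Big)\quad\text{in }\mathbb T^d\times(0,\infty).$$ Energy and discrepancy measures: $d\omega^\varepsilon_t=\big(\frac\varepsilon2|\nabla\mathbf u(\cdot,t)|^2+F_\varepsilon(\mathbf u(\cdot,t))\big)\,dx$, $d\xi^\varepsilon_t=\big(\frac\varepsilon2|\nabla\mathbf u(\cdot,t)|^2-F_\varepsilon(\mathbf u(\cdot,t))\big)\,dx$, with $|\nabla\mathbf u|$ the Frobenius norm of the Jacobian. *)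

theory Defs
  imports "HOL-Analysis.Analysis"
begin

subsection \<open>Potential and reaction term\<close>

definition double_well :: "real \<Rightarrow> real" where
  "double_well u = u\<^sup>2 * (1 - u)\<^sup>2"

text \<open>The oriented interval integral is used, so that the value is also correct for negative \<open>u\<close>.\<close>

definition phi :: "real \<Rightarrow> real" where
  "phi u = (LBINT s=ereal 0..ereal u. sqrt (2 * double_well s))"

definition sigma :: real where
  "sigma = phi 1"

definition F_pot :: "real \<Rightarrow> real \<Rightarrow> real ^ 'n \<Rightarrow> real" where
  "F_pot \<alpha> \<epsilon> v =
     1 / \<epsilon> * (\<Sum>i\<in>UNIV. double_well (v $ i))
     + 1 / (2 * \<epsilon> powr \<alpha>) * (sigma - (\<Sum>i\<in>UNIV. phi (v $ i)))\<^sup>2"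

subsection \<open>Classical solutions on the torus\<close>

text \<open>Functions on the flat torus times \<open>(0,\<infinity>)\<close> are represented by functions
  \<open>u x t\<close> of \<open>x\<close> in Euclidean space that have period 1 in each coordinate of \<open>x\<close>;
  values at times \<open>t \<le> 0\<close> are irrelevant.\<close>

definition space_periodic :: "(real ^ 'd \<Rightarrow> real \<Rightarrow> 'b) \<Rightarrow> bool" where
  "space_periodic u \<longleftrightarrow> (\<forall>t>0. \<forall>x j. u (x + axis j 1) t = u x t)"

definition partial :: "'d \<Rightarrow> (real ^ 'd \<Rightarrow> real ^ 'n) \<Rightarrow> real ^ 'd \<Rightarrow> real ^ 'n" where
  "partial j f x = frechet_derivative f (at x) (axis j 1)"

definition Laplacian :: "(real ^ 'd \<Rightarrow> real ^ 'n) \<Rightarrow> real ^ 'd \<Rightarrow> real ^ 'n" where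
  "Laplacian f x = (\<Sum>j\<in>UNIV. partial j (partial j f) x)"

definition time_deriv :: "(real ^ 'd \<Rightarrow> real \<Rightarrow> real ^ 'n) \<Rightarrow> real ^ 'd \<Rightarrow> real \<Rightarrow> real ^ 'n" where
  "time_deriv u x t = vector_derivative (u x) (at t)"

text \<open>The parabolic regularity class of classical solutions: \<open>u\<close>, its time derivative and its
  spatial derivatives up to second order exist and are jointly continuous for \<open>t > 0\<close>.
  Nothing is assumed at \<open>t = 0\<close>.\<close>

definition C21 :: "(real ^ 'd \<Rightarrow> real \<Rightarrow> real ^ 'n) \<Rightarrow> bool" where
  "C21 u \<longleftrightarrow>
     continuous_on (UNIV \<times> {0<..}) (\<lambda>(x, t). u x t)
   \<and> (\<forall>x. \<forall>t>0. u x differentiable (at t))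
   \<and> continuous_on (UNIV \<times> {0<..}) (\<lambda>(x, t). time_deriv u x t)
   \<and> (\<forall>x. \<forall>t>0. (\<lambda>z. u z t) differentiable (at x))
   \<and> (\<forall>j. continuous_on (UNIV \<times> {0<..}) (\<lambda>(x, t). partial j (\<lambda>z. u z t) x))
   \<and> (\<forall>j x. \<forall>t>0. partial j (\<lambda>z. u z t) differentiable (at x))
   \<and> (\<forall>j k. continuous_on (UNIV \<times> {0<..}) (\<lambda>(x, t). partial k (partial j (\<lambda>z. u z t)) x))"

definition Allen_Cahn_solution :: "real \<Rightarrow> real \<Rightarrow> (real ^ 'd \<Rightarrow> real \<Rightarrow> real ^ 'n) \<Rightarrow> bool" where
  "Allen_Cahn_solution \<alpha> \<epsilon> u \<longleftrightarrow>
     space_periodic u \<and> C21 u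
   \<and> (\<forall>x. \<forall>t>0. \<forall>i.
        \<epsilon> * time_deriv u x t $ i =
          \<epsilon> * Laplacian (\<lambda>z. u z t) x $ i
          - 1 / \<epsilon> * deriv double_well (u x t $ i)
          + 1 / \<epsilon> powr \<alpha> * sqrt (2 * double_well (u x t $ i))
            * (sigma - (\<Sum>j\<in>UNIV. phi (u x t $ j))))"

subsection \<open>Energy and discrepancy measures\<close>

text \<open>The norm on the matrix type \<^typ>\<open>real ^ 'd ^ 'n\<close> is the Frobenius norm.
  Since \<open>u\<close> is periodic, the densities below are periodic, so that the measures with these
  densities with respect to Lebesgue measure on Euclidean space are the periodic extensions of
  the measures on the torus.\<close>

definition energy_density ::
    "real \<Rightarrow> real \<Rightarrow> (real ^ 'd \<Rightarrow> real \<Rightarrow> real ^ 'n) \<Rightarrow> real \<Rightarrow> real ^ 'd \<Rightarrow> real" where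
  "energy_density \<alpha> \<epsilon> u t x =
     \<epsilon> / 2 * (norm (jacobian (\<lambda>z. u z t) (at x)))\<^sup>2 + F_pot \<alpha> \<epsilon> (u x t)"

definition discrepancy_density ::
    "real \<Rightarrow> real \<Rightarrow> (real ^ 'd \<Rightarrow> real \<Rightarrow> real ^ 'n) \<Rightarrow> real \<Rightarrow> real ^ 'd \<Rightarrow> real" where
  "discrepancy_density \<alpha> \<epsilon> u t x =
     \<epsilon> / 2 * (norm (jacobian (\<lambda>z. u z t) (at x)))\<^sup>2 - F_pot \<alpha> \<epsilon> (u x t)"

definition energy_measure ::
    "real \<Rightarrow> real \<Rightarrow> (real ^ 'd \<Rightarrow> real \<Rightarrow> real ^ 'n) \<Rightarrow> real \<Rightarrow> (real ^ 'd) measure" where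
  "energy_measure \<alpha> \<epsilon> u t = density lborel (\<lambda>x. ennreal (energy_density \<alpha> \<epsilon> u t x))"

text \<open>A signed measure \<open>d\<xi> = f dx\<close> is represented by its density \<open>f\<close>. Its positive and negative
  parts are genuine measures; the two lemmas below confirm that they form the Jordan
  decomposition of \<open>f dx\<close>: they are mutually singular, and their difference is \<open>f dx\<close>.\<close>

definition signed_integral :: "('a::euclidean_space \<Rightarrow> real) \<Rightarrow> ('a \<Rightarrow> real) \<Rightarrow> real" where
  "signed_integral f g = (\<integral>x. g x * f x \<partial>lborel)"

definition pos_part :: "('a::euclidean_space \<Rightarrow> real) \<Rightarrow> 'a measure" where
  "pos_part f = density lborel (\<lambda>x. ennreal (max 0 (f x)))"

definition neg_part :: "('a::euclidean_space \<Rightarrow> real) \<Rightarrow> 'a measure" where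
  "neg_part f = density lborel (\<lambda>x. ennreal (max 0 (- f x)))"

lemma pos_neg_part_singular:
  assumes [measurable]: "f \<in> borel_measurable borel"
  shows "\<exists>P\<in>sets borel. emeasure (pos_part f) (- P) = 0 \<and> emeasure (neg_part f) P = 0"
proof (intro bexI conjI)
  let ?P = "{x. 0 \<le> f x}"
  show P: "?P \<in> sets borel" by measurable
  show "emeasure (pos_part f) (- ?P) = 0"
    unfolding pos_part_def using P
    by (subst emeasure_density) (auto intro!: nn_integral_0_iff_AE[THEN iffD2] AE_I2 simp: indicator_def max_def)
  show "emeasure (neg_part f) ?P = 0"
    unfolding neg_part_def using P
    by (subst emeasure_density) (auto intro!: nn_integral_0_iff_AE[THEN iffD2] AE_I2 simp: indicator_def max_def)
qed

lemma pos_part_minus_neg_part: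
  assumes [measurable]: "f \<in> borel_measurable borel" and A [measurable]: "A \<in> sets borel"
    and int: "set_integrable lborel A f"
  shows "measure (pos_part f) A - measure (neg_part f) A = (LINT x:A|lborel. f x)"
proof -
  have i: "integrable lborel (\<lambda>x. indicator A x * f x)"
    using int by (simp add: set_integrable_def)
  have meas: "measure (density lborel (\<lambda>x. ennreal (max 0 (g x)))) A
      = (\<integral>x. indicator A x * max 0 (g x) \<partial>lborel)"
    if [measurable]: "g \<in> borel_measurable borel" for g
    unfolding measure_def
    by (subst emeasure_density, simp, simp, subst integral_eq_nn_integral)
      (auto intro!: arg_cong[where f = enn2real] nn_integral_cong simp: indicator_def)
  have "integrable lborel (\<lambda>x. indicator A x * max 0 (f x))"
    by (rule Bochner_Integration.integrable_bound[OF i]) (auto simp: indicator_def)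
  moreover have "integrable lborel (\<lambda>x. indicator A x * max 0 (- f x))"
    by (rule Bochner_Integration.integrable_bound[OF i]) (auto simp: indicator_def)
  ultimately have "(\<integral>x. indicator A x * max 0 (f x) \<partial>lborel) - (\<integral>x. indicator A x * max 0 (- f x) \<partial>lborel)
      = (\<integral>x. indicator A x * max 0 (f x) - indicator A x * max 0 (- f x) \<partial>lborel)"
    by simp
  also have "\<dots> = (LINT x:A|lborel. f x)"
    unfolding set_lebesgue_integral_def
    by (intro Bochner_Integration.integral_cong) (auto simp: indicator_def max_def)
  finally show ?thesis
    by (simp add: pos_part_def neg_part_def meas)
qed

text \<open>The point \<open>y\<close> of the torus enters through an arbitrary representative in Euclidean space.
  Note the exponent \<open>(d - 1) / 2\<close>.\<close>

definition inverse_heat_kernel :: "real ^ 'd \<Rightarrow> real \<Rightarrow> real ^ 'd \<Rightarrow> real \<Rightarrow> real" where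
  "inverse_heat_kernel y s x t =
     1 / (4 * pi * (s - t)) powr ((real CARD('d) - 1) / 2)
     * exp (- ((norm (x - y))\<^sup>2) / (4 * (s - t)))"

end

theory Submission
  imports Defs "HOL-Probability.Distributions"
begin

text \<open>
  Write \<open>K\<close> for the kernel, \<open>T = s - t\<close>, and \<open>e\<close> and \<open>\<xi>\<close> for the energy and discrepancy densities.
  The system is a gradient flow, \<open>\<epsilon> \<partial>\<^sub>t u = \<epsilon> \<Delta>u - \<nabla>F(u)\<close>, and an integration by parts shows that
  the derivative of the weighted energy \<open>\<integral> K e\<close> is
  \<open>\<integral> \<partial>\<^sub>t K e - \<epsilon> K |\<partial>\<^sub>t u|\<^sup>2 - \<epsilon> \<partial>\<^sub>t u \<bullet> (\<nabla>K \<bullet> \<nabla>)u\<close>. Add and subtract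
  \<open>\<integral> \<epsilon> \<partial>\<^sub>t u \<bullet> (\<nabla>K \<bullet> \<nabla>)u\<close>. One copy completes the square \<open>- \<epsilon> K |\<partial>\<^sub>t u + (\<nabla>K \<bullet> \<nabla>)u / K|\<^sup>2\<close>.
  In the other copy \<open>\<epsilon> \<partial>\<^sub>t u\<close> is replaced by the flow equation; two further integrations by parts
  (\<open>stress_identity\<close>) then leave only second derivatives of \<open>K\<close>. For the inverse heat kernel with
  exponent \<open>(d - 1) / 2\<close>,
  \<open>\<partial>\<^sub>t K + \<Delta>K = - K / (2 T)\<close> and \<open>\<nabla>K \<nabla>K\<^sup>T / K - D\<^sup>2 K = K I / (2 T)\<close>, so that everything except the
  square adds up to \<open>K \<xi> / (2 T)\<close>. The algebra is \<open>monotonicity_pointwise_algebra\<close>, the resulting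
  inequality \<open>weighted_energy_monotonicity\<close>.

  Two points need care. First, the solution is only \<open>C\<^sup>2\<close> in space and \<open>C\<^sup>1\<close> in time, so \<open>\<partial>\<^sub>t \<nabla>u\<close> need
  not exist, and the weighted energy cannot be differentiated under the integral sign. Instead the
  difference of \<open>|\<nabla>u|\<^sup>2\<close> at two times is factored as \<open>\<nabla>(u(\<tau>) - u(t)) \<bullet> \<nabla>(u(\<tau>) + u(t))\<close> and integrated by
  parts before passing to the limit (\<open>weighted_gradient_difference\<close>,
  \<open>weighted_energy_derivative\<close>). Second, all integrals extend over the whole space: periodicity makes
  the solution and its derivatives bounded, uniformly on compact time intervals, while the kernel and
  its derivatives decay like Gaussians. This justifies the integrations by parts and the dominated
  convergence.
\<close>

section \<open>Gaussian decay\<close>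

text \<open>Up to a factor the Gaussian is a product of one-dimensional normal densities, so that
  Tonelli's theorem for the product structure of Lebesgue measure reduces the claim to dimension 1.\<close>

lemma integrable_gaussian:
  fixes y :: "'a::euclidean_space"
  assumes "0 < c"
  shows "integrable lborel (\<lambda>x. exp (- c * (norm (x - y))\<^sup>2))"
proof -
  let ?f = "\<lambda>b z. exp (- c * (z - y \<bullet> b)\<^sup>2)"
  have one: "(\<integral>\<^sup>+z. ennreal (?f b z) \<partial>lborel) < \<infinity>" for b
  proof -
    define \<sigma> where "\<sigma> = sqrt (1 / (2 * c))"
    have \<sigma>: "0 < \<sigma>" "\<sigma>\<^sup>2 = 1 / (2 * c)"
      using assms by (auto simp: \<sigma>_def)
    have "integrable lborel (\<lambda>z. sqrt (2 * pi * \<sigma>\<^sup>2) * normal_density (y \<bullet> b) \<sigma> z)"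
      using \<sigma> by (intro integrable_mult_right integrable_normal_density)
    moreover have "sqrt (2 * pi * \<sigma>\<^sup>2) * normal_density (y \<bullet> b) \<sigma> z = ?f b z" for z
      using \<sigma> assms by (simp add: normal_density_def field_simps)
    ultimately have "integrable lborel (?f b)"
      by simp
    then show ?thesis
      by (simp add: integrable_iff_bounded)
  qed
  have eq: "exp (- c * (norm (x - y))\<^sup>2) = (\<Prod>b\<in>Basis. ?f b (x \<bullet> b))" for x
  proof -
    have "(norm (x - y))\<^sup>2 = (\<Sum>b\<in>Basis. (x \<bullet> b - y \<bullet> b)\<^sup>2)"
      unfolding power2_norm_eq_inner by (subst euclidean_inner) (simp add: inner_diff_left power2_eq_square)
    then show ?thesis
      by (simp add: sum_distrib_left exp_sum)
  qed
  have "(\<integral>\<^sup>+x. ennreal (exp (- c * (norm (x - y))\<^sup>2)) \<partial>lborel)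
      = (\<integral>\<^sup>+x. (\<Prod>b\<in>Basis. ennreal (?f b (x \<bullet> b))) \<partial>lborel)"
    unfolding eq by (simp add: prod_ennreal)
  also have "\<dots> = (\<Prod>b\<in>Basis. (\<integral>\<^sup>+z. ennreal (?f b z) \<partial>lborel))"
    by (subst nn_integral_lborel_prod) auto
  also have "\<dots> < \<infinity>"
    using one by (simp add: ennreal_prod_eq_top less_top[symmetric])
  finally show ?thesis
    by (simp add: integrable_iff_bounded)
qed

text \<open>All integrands of the proof are products of a bounded function with the kernel and
  polynomial factors. The rate \<open>c\<close> is existentially quantified, because polynomial factors and
  translations are absorbed by making it smaller.\<close>

definition gaussian_decay :: "'a::euclidean_space \<Rightarrow> ('a \<Rightarrow> real) \<Rightarrow> bool" where
  "gaussian_decay y g \<longleftrightarrow> (\<exists>C c. 0 < c \<and> (\<forall>x. \<bar>g x\<bar> \<le> C * exp (- c * (norm (x - y))\<^sup>2)))"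

lemma gaussian_decayI:
  "0 < c \<Longrightarrow> (\<And>x. \<bar>g x\<bar> \<le> C * exp (- c * (norm (x - y))\<^sup>2)) \<Longrightarrow> gaussian_decay y g"
  by (auto simp: gaussian_decay_def)

lemma gaussian_decayE:
  assumes "gaussian_decay y g"
  obtains C c where "0 < c" "0 \<le> C" "\<And>x. \<bar>g x\<bar> \<le> C * exp (- c * (norm (x - y))\<^sup>2)"
proof -
  obtain C c where C: "0 < c" "\<And>x. \<bar>g x\<bar> \<le> C * exp (- c * (norm (x - y))\<^sup>2)"
    using assms by (auto simp: gaussian_decay_def)
  moreover have "0 \<le> C"
    using C(2)[of y] by simp
  ultimately show ?thesis
    using that by blast
qed

lemma gaussian_decay_integrable:
  assumes "gaussian_decay y g" "g \<in> borel_measurable borel"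
  shows "integrable lborel g"
proof -
  obtain C c where C: "0 < c" "0 \<le> C" "\<And>x. \<bar>g x\<bar> \<le> C * exp (- c * (norm (x - y))\<^sup>2)"
    using assms(1) by (rule gaussian_decayE) blast
  have "integrable lborel (\<lambda>x. C * exp (- c * (norm (x - y))\<^sup>2))"
    by (rule integrable_mult_right[OF integrable_gaussian[OF C(1)]])
  then show ?thesis
    by (rule Bochner_Integration.integrable_bound) (use assms C in auto)
qed

lemma gaussian_decay_mult_bounded:
  assumes "gaussian_decay y g" "\<And>x. \<bar>f x\<bar> \<le> B"
  shows "gaussian_decay y (\<lambda>x. g x * f x)"
proof -
  obtain C c where C: "0 < c" "0 \<le> C" "\<And>x. \<bar>g x\<bar> \<le> C * exp (- c * (norm (x - y))\<^sup>2)"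
    using assms(1) by (rule gaussian_decayE) blast
  show ?thesis
  proof (rule gaussian_decayI[OF C(1)])
    fix x
    have "\<bar>g x * f x\<bar> \<le> (C * exp (- c * (norm (x - y))\<^sup>2)) * B"
      unfolding abs_mult using C assms(2)[of x] by (intro mult_mono) auto
    then show "\<bar>g x * f x\<bar> \<le> (C * B) * exp (- c * (norm (x - y))\<^sup>2)"
      by (simp add: mult_ac)
  qed
qed

lemma gaussian_decay_cmult: "gaussian_decay y g \<Longrightarrow> gaussian_decay y (\<lambda>x. a * g x)"
  using gaussian_decay_mult_bounded[of y g "\<lambda>_. a" "\<bar>a\<bar>"] by (simp add: mult.commute)

lemma gaussian_decay_add:
  assumes "gaussian_decay y f" "gaussian_decay y g"
  shows "gaussian_decay y (\<lambda>x. f x + g x)"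
proof -
  obtain A a where A: "0 < a" "0 \<le> A" "\<And>x. \<bar>f x\<bar> \<le> A * exp (- a * (norm (x - y))\<^sup>2)"
    using assms(1) by (rule gaussian_decayE) blast
  obtain C c where C: "0 < c" "0 \<le> C" "\<And>x. \<bar>g x\<bar> \<le> C * exp (- c * (norm (x - y))\<^sup>2)"
    using assms(2) by (rule gaussian_decayE) blast
  show ?thesis
  proof (rule gaussian_decayI)
    show "0 < min a c" using A C by simp
    fix x
    have "\<bar>f x + g x\<bar> \<le> A * exp (- a * (norm (x - y))\<^sup>2) + C * exp (- c * (norm (x - y))\<^sup>2)"
      using A(3)[of x] C(3)[of x] by linarith
    also have "\<dots> \<le> A * exp (- min a c * (norm (x - y))\<^sup>2) + C * exp (- min a c * (norm (x - y))\<^sup>2)"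
      using A C by (intro add_mono mult_left_mono) (auto intro: mult_right_mono)
    finally show "\<bar>f x + g x\<bar> \<le> (A + C) * exp (- min a c * (norm (x - y))\<^sup>2)"
      by (simp add: algebra_simps)
  qed
qed

text \<open>Part of the decay pays for the polynomial factor: \<open>b (1 + r) \<le> exp (b r)\<close> for
  \<open>b \<le> 1\<close>, and with \<open>b \<le> c / 2\<close> half of the exponent is left.\<close>

lemma gaussian_decay_mult_square:
  assumes "gaussian_decay y g"
  shows "gaussian_decay y (\<lambda>x. (1 + (norm (x - y))\<^sup>2) * g x)"
proof -
  obtain C c where C: "0 < c" "0 \<le> C" "\<And>x. \<bar>g x\<bar> \<le> C * exp (- c * (norm (x - y))\<^sup>2)"
    using assms(1) by (rule gaussian_decayE) blast
  define b where "b = min c 2 / 2"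
  have b: "0 < b" "b \<le> 1" "b \<le> c / 2" using C by (auto simp: b_def min_def)
  show ?thesis
  proof (rule gaussian_decayI)
    show "0 < c / 2" using C by simp
    fix x
    define r where "r = (norm (x - y))\<^sup>2"
    have r: "0 \<le> r" by (simp add: r_def)
    have "b * (1 + r) \<le> 1 + b * r" using b by (simp add: algebra_simps)
    also have "\<dots> \<le> exp (b * r)" by (rule exp_ge_add_one_self)
    also have "\<dots> \<le> exp (c / 2 * r)" using b mult_right_mono[OF b(3) r] by simp
    finally have "1 + r \<le> exp (c / 2 * r) / b" using b by (simp add: field_simps)
    then have "(1 + r) * \<bar>g x\<bar> \<le> exp (c / 2 * r) / b * (C * exp (- c * r))"
      using C(3)[of x] r b by (intro mult_mono) (auto simp: r_def)
    also have "\<dots> = C / b * (exp (c / 2 * r) * exp (- c * r))" by (simp add: field_simps)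
    also have "exp (c / 2 * r) * exp (- c * r) = exp (- (c / 2) * r)"
      by (simp flip: exp_add add: field_simps)
    finally show "\<bar>(1 + (norm (x - y))\<^sup>2) * g x\<bar> \<le> C / b * exp (- (c / 2) * (norm (x - y))\<^sup>2)"
      using r by (simp add: abs_mult r_def)
  qed
qed

lemma gaussian_decay_le:
  assumes "gaussian_decay y g" "\<And>x. \<bar>f x\<bar> \<le> \<bar>g x\<bar>"
  shows "gaussian_decay y f"
  using assms unfolding gaussian_decay_def by (meson order_trans)

text \<open>Since \<open>|x - y|\<^sup>2 \<le> 2 |x + e - y|\<^sup>2 + 2 |e|\<^sup>2\<close>, Gaussian bounds survive small
  translations. Thus a bound on a derivative also dominates its values at the intermediate points of
  the mean value theorem.\<close>

lemma gaussian_shift_le: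
  fixes x y e :: "'a::euclidean_space"
  assumes "0 < c"
  shows "exp (- c * (norm (x + e - y))\<^sup>2) \<le> exp (c * (norm e)\<^sup>2) * exp (- (c / 2) * (norm (x - y))\<^sup>2)"
proof -
  have "norm (x - y) \<le> norm (x + e - y) + norm e"
    using norm_triangle_ineq4[of "x + e - y" e] by simp
  then have "(norm (x - y))\<^sup>2 \<le> (norm (x + e - y) + norm e)\<^sup>2"
    by (intro power_mono) auto
  also have "\<dots> \<le> 2 * (norm (x + e - y))\<^sup>2 + 2 * (norm e)\<^sup>2"
    using zero_le_power2[of "norm (x + e - y) - norm e"] by (simp add: power2_eq_square algebra_simps)
  finally have "c * (norm (x - y))\<^sup>2 \<le> c * (2 * (norm (x + e - y))\<^sup>2 + 2 * (norm e)\<^sup>2)"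
    using assms by simp
  then show ?thesis
    by (simp flip: exp_add add: algebra_simps)
qed

section \<open>Integration by parts and differentiation of integrals\<close>

text \<open>Multivariate statements below are reduced to the mean value theorem on a line by this
  chain rule.\<close>

lemma has_real_derivative_along_line:
  fixes g :: "'a::real_normed_vector \<Rightarrow> real"
  assumes "(g has_derivative g') (at (x + r *\<^sub>R e))"
  shows "((\<lambda>r. g (x + r *\<^sub>R e)) has_real_derivative g' e) (at r)"
proof -
  interpret bounded_linear g' using assms by (rule has_derivative_bounded_linear)
  have "((\<lambda>r. g (x + r *\<^sub>R e)) has_derivative (\<lambda>h. g' (h *\<^sub>R e))) (at r)"
    using assms by (auto intro!: derivative_eq_intros has_derivative_compose[of "\<lambda>r. x + r *\<^sub>R e" _ _ _ g])
  then show ?thesis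
    by (simp add: has_field_derivative_def scale mult.commute[of _ "g' e"] mult_commute_abs)
qed

lemma lborel_translate:
  fixes g :: "'a::euclidean_space \<Rightarrow> real"
  assumes "integrable lborel g" "g \<in> borel_measurable borel"
  shows "integrable lborel (\<lambda>x. g (x + e))" "(\<integral>x. g (x + e) \<partial>lborel) = (\<integral>x. g x \<partial>lborel)"
proof -
  have eq: "lborel = distr lborel borel ((+) e)" by (simp add: lborel_distr_plus)
  have "integrable (distr lborel borel ((+) e)) g" using assms by (simp flip: eq)
  then show "integrable lborel (\<lambda>x. g (x + e))"
    using assms by (subst (asm) integrable_distr_eq) (auto simp: add.commute)
  show "(\<integral>x. g (x + e) \<partial>lborel) = (\<integral>x. g x \<partial>lborel)"
    using assms by (subst (2) eq, subst integral_distr) (auto simp: add.commute)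
qed

text \<open>The integral of each difference quotient vanishes, because Lebesgue measure is
  translation invariant. The quotients converge to the directional derivative and are dominated by a
  Gaussian. This is the only form of the divergence theorem that is used; no boundary terms arise.\<close>

lemma integral_directional_derivative_eq_0:
  fixes g :: "'a::euclidean_space \<Rightarrow> real"
  assumes deriv: "\<And>x. (g has_derivative g' x) (at x)"
    and "gaussian_decay y g" and decay': "gaussian_decay y (\<lambda>x. g' x e)"
  shows "integrable lborel (\<lambda>x. g' x e)" and "(\<integral>x. g' x e \<partial>lborel) = 0"
proof -
  define r where "r n = inverse (real (Suc n))" for n
  have r: "0 < r n" "r n \<le> 1" for n by (auto simp: r_def field_simps)
  define S where "S n x = (g (x + r n *\<^sub>R e) - g x) / r n" for n x
  have "continuous_on UNIV g"
    using deriv by (meson continuous_at_imp_continuous_on has_derivative_continuous)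
  then have [measurable]: "g \<in> borel_measurable borel"
    by (rule borel_measurable_continuous_onI)
  have int: "integrable lborel g"
    using assms by (intro gaussian_decay_integrable) auto
  obtain C c where C: "0 < c" "0 \<le> C" "\<And>x. \<bar>g' x e\<bar> \<le> C * exp (- c * (norm (x - y))\<^sup>2)"
    using decay' by (rule gaussian_decayE) blast
  define G where "G x = C * exp (c * (norm e)\<^sup>2) * exp (- (c / 2) * (norm (x - y))\<^sup>2)" for x
  have "integrable lborel G"
    unfolding G_def using integrable_gaussian[of "c / 2" y] C by (intro integrable_mult_right) auto
  moreover have "\<bar>S n x\<bar> \<le> G x" for n x
  proof -
    have "\<exists>\<theta>. 0 < \<theta> \<and> \<theta> < r n \<and> g (x + r n *\<^sub>R e) - g (x + 0 *\<^sub>R e) = (r n - 0) * g' (x + \<theta> *\<^sub>R e) e"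
      using r by (intro MVT2 has_real_derivative_along_line deriv)
    then obtain \<theta> where \<theta>: "0 < \<theta>" "\<theta> < r n" "S n x = g' (x + \<theta> *\<^sub>R e) e"
      using r[of n] by (auto simp: S_def)
    have "\<bar>S n x\<bar> \<le> C * exp (- c * (norm (x + \<theta> *\<^sub>R e - y))\<^sup>2)"
      unfolding \<theta> by (rule C)
    also have "\<dots> \<le> C * (exp (c * (norm (\<theta> *\<^sub>R e))\<^sup>2) * exp (- (c / 2) * (norm (x - y))\<^sup>2))"
      using C by (intro mult_left_mono gaussian_shift_le)
    also have "(norm (\<theta> *\<^sub>R e))\<^sup>2 \<le> (norm e)\<^sup>2"
      using \<theta> r[of n] by (intro power_mono) (auto intro: mult_left_le_one_le)
    finally show ?thesis
      using C by (simp add: G_def mult_ac mult_left_mono)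
  qed
  moreover have lim: "(\<lambda>n. S n x) \<longlonglongrightarrow> g' x e" for x
  proof -
    have "((\<lambda>r. g (x + r *\<^sub>R e)) has_real_derivative g' x e) (at 0)"
      using has_real_derivative_along_line[of g "g' x" x 0 e] deriv by simp
    then have "((\<lambda>h. (g (x + h *\<^sub>R e) - g x) / h) \<longlongrightarrow> g' x e) (at 0)"
      by (simp add: has_field_derivative_iff)
    moreover have "filterlim r (at 0) sequentially"
      unfolding r_def using LIMSEQ_inverse_real_of_nat by (auto simp: filterlim_at)
    ultimately show ?thesis
      unfolding S_def by (rule filterlim_compose)
  qed
  moreover have meas: "S n \<in> borel_measurable lborel" for n
    unfolding S_def by measurable
  moreover have "(\<lambda>x. g' x e) \<in> borel_measurable lborel"
    by (rule borel_measurable_LIMSEQ_real[OF lim meas])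
  ultimately have *: "(\<lambda>n. \<integral>x. S n x \<partial>lborel) \<longlonglongrightarrow> (\<integral>x. g' x e \<partial>lborel)"
    and "integrable lborel (\<lambda>x. g' x e)"
    by (auto intro!: integral_dominated_convergence[where w = G]
        integrable_dominated_convergence[where w = G and s = S])
  then show "integrable lborel (\<lambda>x. g' x e)" by simp
  have "(\<integral>x. S n x \<partial>lborel) = 0" for n
    unfolding S_def using lborel_translate[OF int] int by simp
  with * show "(\<integral>x. g' x e \<partial>lborel) = 0"
    by (simp add: LIMSEQ_const_iff)
qed

text \<open>More flexible than differentiation under the integral sign: \<open>k \<tau>\<close> may be any function
  with the same integral as the increment of the integrand. In the application it is the increment
  after an integration by parts, whose difference quotients converge although those of the integrand
  itself need not.\<close>

lemma has_real_derivative_integral_dominated: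
  fixes I :: "real \<Rightarrow> real" and k :: "real \<Rightarrow> 'a \<Rightarrow> real"
  assumes "0 < \<delta>" and G: "integrable M G"
    and I: "\<And>\<tau>. \<bar>\<tau> - t\<bar> < \<delta> \<Longrightarrow> I \<tau> - I t = (\<integral>x. k \<tau> x \<partial>M)"
    and meas: "\<And>\<tau>. \<bar>\<tau> - t\<bar> < \<delta> \<Longrightarrow> k \<tau> \<in> borel_measurable M"
    and bound: "\<And>\<tau> x. \<bar>\<tau> - t\<bar> < \<delta> \<Longrightarrow> \<bar>k \<tau> x\<bar> \<le> \<bar>\<tau> - t\<bar> * G x"
    and lim: "\<And>x. ((\<lambda>\<tau>. k \<tau> x / (\<tau> - t)) \<longlongrightarrow> k' x) (at t)"
  shows "integrable M k'" and "(I has_real_derivative (\<integral>x. k' x \<partial>M)) (at t)"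
proof -
  have *: "integrable M k' \<and> (\<lambda>n. (I (X n) - I t) / (X n - t)) \<longlonglongrightarrow> (\<integral>x. k' x \<partial>M)"
    if X: "\<And>n. X n \<noteq> t" "X \<longlonglongrightarrow> t" for X
  proof -
    define S where "S n x = (if \<bar>X n - t\<bar> < \<delta> then k (X n) x / (X n - t) else 0)" for n x
    have ev: "eventually (\<lambda>n. \<bar>X n - t\<bar> < \<delta>) sequentially"
      using tendstoD[OF X(2) \<open>0 < \<delta>\<close>] by (simp add: dist_real_def)
    have bS: "\<bar>S n x\<bar> \<le> \<bar>G x\<bar>" for n x
    proof (cases "\<bar>X n - t\<bar> < \<delta>")
      case True
      have "\<bar>k (X n) x\<bar> \<le> \<bar>X n - t\<bar> * \<bar>G x\<bar>"
        using bound[OF True, of x] by (rule order_trans) (simp add: mult_left_mono)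
      then show ?thesis
        using True X(1)[of n] by (simp add: S_def divide_simps mult.commute)
    qed (simp add: S_def)
    have lS: "(\<lambda>n. S n x) \<longlonglongrightarrow> k' x" for x
    proof -
      have "filterlim X (at t) sequentially"
        using X by (auto simp: filterlim_at)
      then have "(\<lambda>n. k (X n) x / (X n - t)) \<longlonglongrightarrow> k' x"
        by (rule filterlim_compose[OF lim])
      moreover have "eventually (\<lambda>n. k (X n) x / (X n - t) = S n x) sequentially"
        using ev by eventually_elim (simp add: S_def)
      ultimately show ?thesis
        by (rule Lim_transform_eventually)
    qed
    have mS: "S n \<in> borel_measurable M" for n
    proof (cases "\<bar>X n - t\<bar> < \<delta>")
      case True
      have [measurable]: "k (X n) \<in> borel_measurable M" by (rule meas[OF True])
      show ?thesis using True unfolding S_def by simp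
    qed (simp add: S_def[abs_def])
    have mk': "k' \<in> borel_measurable M"
      by (rule borel_measurable_LIMSEQ_real[OF lS mS])
    have "integrable M (\<lambda>x. \<bar>G x\<bar>)" using G by simp
    then have "(\<lambda>n. \<integral>x. S n x \<partial>M) \<longlonglongrightarrow> (\<integral>x. k' x \<partial>M)" and "integrable M k'"
      using bS lS mS mk' by (auto intro!: integral_dominated_convergence[where w = "\<lambda>x. \<bar>G x\<bar>"]
        integrable_dominated_convergence[where w = "\<lambda>x. \<bar>G x\<bar>" and s = S])
    moreover have "eventually (\<lambda>n. (\<integral>x. S n x \<partial>M) = (I (X n) - I t) / (X n - t)) sequentially"
      using ev by eventually_elim (simp add: S_def I)
    ultimately show ?thesis
      by (auto intro: Lim_transform_eventually)
  qed
  have "(\<lambda>n. t + inverse (real (Suc n))) \<longlonglongrightarrow> t"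
    using tendsto_add[OF tendsto_const[of t] LIMSEQ_inverse_real_of_nat] by simp
  then show "integrable M k'" using *[of "\<lambda>n. t + inverse (real (Suc n))"] by simp
  show "(I has_real_derivative (\<integral>x. k' x \<partial>M)) (at t)"
    unfolding has_field_derivative_iff tendsto_at_iff_sequentially comp_def using * by auto
qed

lemma integral_weighted_derivative_eq_0:
  fixes P f :: "'a::euclidean_space \<Rightarrow> real"
  assumes P: "\<And>x. (P has_derivative P' x) (at x)" "gaussian_decay y P" "gaussian_decay y (\<lambda>x. P' x e)"
    and f: "\<And>x. (f has_derivative f' x) (at x)" "bounded (range f)" "bounded (range (\<lambda>x. f' x e))"
  shows "integrable lborel (\<lambda>x. P' x e * f x + P x * f' x e)"
    and "(\<integral>x. P' x e * f x + P x * f' x e \<partial>lborel) = 0"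
proof -
  obtain B where B: "\<And>x. \<bar>f x\<bar> \<le> B" using f(2) by (auto simp: bounded_iff)
  obtain B' where B': "\<And>x. \<bar>f' x e\<bar> \<le> B'" using f(3) by (auto simp: bounded_iff)
  have d: "((\<lambda>x. P x * f x) has_derivative (\<lambda>h. P' x h * f x + P x * f' x h)) (at x)" for x
    using has_derivative_mult[OF P(1) f(1)] by (simp add: add.commute)
  have 1: "gaussian_decay y (\<lambda>x. P x * f x)"
    by (rule gaussian_decay_mult_bounded[OF P(2) B])
  have 2: "gaussian_decay y (\<lambda>x. P' x e * f x + P x * f' x e)"
    by (intro gaussian_decay_add gaussian_decay_mult_bounded[OF P(3) B] gaussian_decay_mult_bounded[OF P(2) B'])
  show "integrable lborel (\<lambda>x. P' x e * f x + P x * f' x e)"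
    "(\<integral>x. P' x e * f x + P x * f' x e \<partial>lborel) = 0"
    by (rule integral_directional_derivative_eq_0[OF d 1 2])+
qed

section \<open>The inverse heat kernel\<close>

lemma inverse_heat_kernel_nonneg: "0 \<le> inverse_heat_kernel y s x t"
  by (simp add: inverse_heat_kernel_def)

lemma inverse_heat_kernel_space_derivative:
  fixes x y :: "real ^ 'd"
  shows
  "((\<lambda>x. inverse_heat_kernel y s x t) has_derivative
    (\<lambda>h. - ((x - y) \<bullet> h) / (2 * (s - t)) * inverse_heat_kernel y s x t)) (at x)"
proof -
  have "((\<lambda>x. c * exp (- ((x - y) \<bullet> (x - y)) / \<tau>)) has_derivative
      (\<lambda>h. - 2 * ((x - y) \<bullet> h) / \<tau> * (c * exp (- ((x - y) \<bullet> (x - y)) / \<tau>)))) (at x)" for c \<tau>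
    by (cases "\<tau> = 0") (auto intro!: derivative_eq_intros simp: inner_commute fun_eq_iff field_simps)
  from this[of "1 / (4 * pi * (s - t)) powr ((real CARD('d) - 1) / 2)" "4 * (s - t)"] show ?thesis
    unfolding inverse_heat_kernel_def power2_norm_eq_inner
    by (rule has_derivative_eq_rhs) (simp add: fun_eq_iff divide_simps)
qed

lemma inverse_heat_kernel_time_derivative:
  fixes x y :: "real ^ 'd"
  assumes "t < s"
  shows "((\<lambda>t. inverse_heat_kernel y s x t) has_real_derivative
    ((real CARD('d) - 1) / (2 * (s - t)) - (norm (x - y))\<^sup>2 / (4 * (s - t)\<^sup>2))
      * inverse_heat_kernel y s x t) (at t)"
proof -
  define a where "a = (real CARD('d) - 1) / 2"
  define r where "r = (norm (x - y))\<^sup>2"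
  have *: "inverse_heat_kernel y s x = (\<lambda>t. (4 * pi * (s - t)) powr (- a) * exp (- r / (4 * (s - t))))"
    by (simp add: inverse_heat_kernel_def a_def r_def powr_minus_divide fun_eq_iff)
  have pos: "0 < 4 * pi * (s - t)" using assms by simp
  have "((\<lambda>t. (4 * pi * (s - t)) powr (- a)) has_real_derivative
      - a * (4 * pi * (s - t)) powr (- a - 1) * (- (4 * pi))) (at t)"
    using pos by (auto intro!: derivative_eq_intros DERIV_fun_powr)
  moreover have "(4 * pi * (s - t)) powr (- a - 1) = (4 * pi * (s - t)) powr (- a) / (4 * pi * (s - t))"
    using pos by (simp add: powr_diff)
  moreover have "- a * (p / (4 * pi * (s - t))) * (- (4 * pi)) = a / (s - t) * p" for p
    using assms by (simp add: field_simps)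
  ultimately have d1: "((\<lambda>t. (4 * pi * (s - t)) powr (- a)) has_real_derivative
      a / (s - t) * (4 * pi * (s - t)) powr (- a)) (at t)"
    by simp
  have d2: "((\<lambda>t. exp (- r / (4 * (s - t)))) has_real_derivative
      - r / (4 * (s - t)\<^sup>2) * exp (- r / (4 * (s - t)))) (at t)"
  proof -
    have "((\<lambda>t. - r / (4 * (s - t))) has_real_derivative - r / (4 * (s - t)\<^sup>2)) (at t)"
    proof -
      have "((\<lambda>t. - r / 4 * inverse (s - t)) has_real_derivative - r / 4 * (inverse (s - t) ^ 2)) (at t)"
        using assms by (auto intro!: derivative_eq_intros simp: power2_eq_square)
      moreover have "(\<lambda>t. - r / 4 * inverse (s - t)) = (\<lambda>t. - r / (4 * (s - t)))"
        by (simp add: inverse_eq_divide)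
      moreover have "- r / 4 * (inverse (s - t) ^ 2) = - r / (4 * (s - t)\<^sup>2)"
        by (simp add: inverse_eq_divide power_divide)
      ultimately show ?thesis by (simp only:)
    qed
    from DERIV_fun_exp[OF this] show ?thesis by (simp add: mult.commute)
  qed
  show ?thesis
    unfolding * using DERIV_mult[OF d1 d2] unfolding a_def[symmetric] r_def[symmetric]
    by (rule DERIV_cong) (simp add: a_def field_simps)
qed

lemma inverse_heat_kernel_le:
  fixes x y :: "real ^ 'd"
  assumes "0 < \<delta>" "\<delta> \<le> s - t" "s - t \<le> m"
  shows "inverse_heat_kernel y s x t
    \<le> 1 / (4 * pi * \<delta>) powr ((real CARD('d) - 1) / 2) * exp (- (1 / (4 * m)) * (norm (x - y))\<^sup>2)"
proof -
  have c: "1 \<le> real CARD('d)" by (simp add: Suc_leI)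
  have "1 / (4 * pi * (s - t)) powr ((real CARD('d) - 1) / 2) \<le> 1 / (4 * pi * \<delta>) powr ((real CARD('d) - 1) / 2)"
    using assms c by (intro divide_left_mono powr_mono2 mult_pos_pos) auto
  moreover have "(norm (x - y))\<^sup>2 / (4 * m) \<le> (norm (x - y))\<^sup>2 / (4 * (s - t))"
    using assms by (intro divide_left_mono) auto
  ultimately show ?thesis
    unfolding inverse_heat_kernel_def by (intro mult_mono) auto
qed

lemma inverse_heat_kernel_decay:
  fixes y :: "real ^ 'd"
  assumes "t < s"
  shows "gaussian_decay y (\<lambda>x. inverse_heat_kernel y s x t)"
proof (rule gaussian_decayI)
  show "\<bar>inverse_heat_kernel y s x t\<bar> \<le> 1 / (4 * pi * (s - t)) powr ((real CARD('d) - 1) / 2)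
      * exp (- (1 / (4 * (s - t))) * (norm (x - y))\<^sup>2)" for x
    unfolding abs_of_nonneg[OF inverse_heat_kernel_nonneg]
    using assms by (intro inverse_heat_kernel_le) auto
qed (use assms in simp)

text \<open>For times within \<open>(s - t) / 2\<close> of \<open>t\<close> the distance to the singular time \<open>s\<close> stays between
  \<open>(s - t) / 2\<close> and \<open>3 (s - t) / 2\<close>, so that one Gaussian dominates the time derivative of the kernel
  on this whole interval.\<close>

lemma inverse_heat_kernel_time_Lipschitz:
  fixes y :: "real ^ 'd"
  assumes "t < s"
  obtains G where "gaussian_decay y G" "continuous_on UNIV G"
    "\<And>x \<tau>. \<bar>\<tau> - t\<bar> < (s - t) / 2 \<Longrightarrow>
      \<bar>inverse_heat_kernel y s x \<tau> - inverse_heat_kernel y s x t\<bar> \<le> \<bar>\<tau> - t\<bar> * G x"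
proof -
  define \<delta> where "\<delta> = (s - t) / 2"
  have \<delta>: "0 < \<delta>" using assms by (simp add: \<delta>_def)
  define M where "M = 1 / (4 * pi * \<delta>) powr ((real CARD('d) - 1) / 2)"
  define A where "A = real CARD('d) / (2 * \<delta>) + 1 / (4 * \<delta>\<^sup>2)"
  define E where "E x = exp (- (1 / (4 * (3 * \<delta>))) * (norm (x - y))\<^sup>2)" for x
  define G where "G x = A * M * ((1 + (norm (x - y))\<^sup>2) * E x)" for x
  have AM: "0 \<le> A" "0 \<le> M" using \<delta> by (auto simp: A_def M_def)
  have "gaussian_decay y E"
    unfolding E_def using \<delta> by (intro gaussian_decayI[of "1 / (4 * (3 * \<delta>))" _ 1]) auto
  then have "gaussian_decay y G"
    unfolding G_def by (intro gaussian_decay_cmult gaussian_decay_mult_square)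
  moreover have "continuous_on UNIV G"
    unfolding G_def E_def by (intro continuous_intros)
  moreover have "\<bar>inverse_heat_kernel y s x \<tau> - inverse_heat_kernel y s x t\<bar> \<le> \<bar>\<tau> - t\<bar> * G x"
    if \<tau>: "\<bar>\<tau> - t\<bar> < (s - t) / 2" for x \<tau>
  proof -
    have "norm (inverse_heat_kernel y s x \<tau> - inverse_heat_kernel y s x t) \<le> G x * norm (\<tau> - t)"
    proof (rule field_differentiable_bound[where S = "{t - \<delta><..<t + \<delta>}"])
      fix z assume z: "z \<in> {t - \<delta><..<t + \<delta>}"
      then have b: "\<delta> \<le> s - z" "s - z \<le> 3 * \<delta>" "z < s"
        using assms by (auto simp: \<delta>_def field_simps)
      show "(inverse_heat_kernel y s x has_field_derivative
          ((real CARD('d) - 1) / (2 * (s - z)) - (norm (x - y))\<^sup>2 / (4 * (s - z)\<^sup>2))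
          * inverse_heat_kernel y s x z) (at z within {t - \<delta><..<t + \<delta>})"
        using inverse_heat_kernel_time_derivative[OF b(3)] by (rule has_field_derivative_at_within)
      have c: "1 \<le> real CARD('d)" by (simp add: Suc_leI)
      define r where "r = (norm (x - y))\<^sup>2"
      have r: "0 \<le> r" by (simp add: r_def)
      have "(real CARD('d) - 1) / (2 * (s - z)) \<le> real CARD('d) / (2 * \<delta>)"
        using b \<delta> c by (intro frac_le) auto
      moreover have "0 \<le> (real CARD('d) - 1) / (2 * (s - z))"
        using b \<delta> c by simp
      moreover have "r / (4 * (s - z)\<^sup>2) \<le> r / (4 * \<delta>\<^sup>2)"
        using b \<delta> r by (intro divide_left_mono mult_left_mono power_mono mult_pos_pos zero_less_power) auto
      moreover have "0 \<le> r / (4 * (s - z)\<^sup>2)" using r by simp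
      ultimately have "\<bar>(real CARD('d) - 1) / (2 * (s - z)) - r / (4 * (s - z)\<^sup>2)\<bar>
          \<le> real CARD('d) / (2 * \<delta>) + r / (4 * \<delta>\<^sup>2)"
        by linarith
      also have "\<dots> \<le> A * (1 + r)"
        using \<delta> r by (simp add: A_def algebra_simps add_divide_distrib)
      finally have 1: "\<bar>(real CARD('d) - 1) / (2 * (s - z)) - r / (4 * (s - z)\<^sup>2)\<bar> \<le> A * (1 + r)" .
      have 2: "\<bar>inverse_heat_kernel y s x z\<bar> \<le> M * E x"
        using inverse_heat_kernel_le[OF \<delta> b(1,2), of y x] inverse_heat_kernel_nonneg[of y s x z]
        by (simp add: M_def E_def)
      have "\<bar>((real CARD('d) - 1) / (2 * (s - z)) - r / (4 * (s - z)\<^sup>2)) * inverse_heat_kernel y s x z\<bar>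
          \<le> (A * (1 + r)) * (M * E x)"
        unfolding abs_mult using AM r by (intro mult_mono 1 2) auto
      then show "norm (((real CARD('d) - 1) / (2 * (s - z)) - (norm (x - y))\<^sup>2 / (4 * (s - z)\<^sup>2))
          * inverse_heat_kernel y s x z) \<le> G x"
        by (simp add: G_def r_def mult_ac)
    next
      have "\<bar>\<tau> - t\<bar> < \<delta>" using \<tau> by (simp add: \<delta>_def)
      then show "\<tau> \<in> {t - \<delta><..<t + \<delta>}" by (auto simp: abs_less_iff)
    qed (use \<delta> in simp_all)
    then show ?thesis by (simp add: mult.commute)
  qed
  ultimately show ?thesis using that by blast
qed

section \<open>Periodic functions\<close>

lemma periodic_translate:
  fixes f :: "real ^ 'd \<Rightarrow> 'b"
  assumes "\<And>x j. f (x + axis j 1) = f x"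
  shows "f (x + (\<chi> j. of_int (n j))) = f x"
proof -
  have nat: "f (x + axis j (of_nat m)) = f x" for x j m
  proof (induction m)
    case 0
    have "axis j 0 = (0 :: real ^ 'd)" by (simp add: axis_def vec_eq_iff)
    then show ?case by (simp only: of_nat_0 add_0_right)
  next
    case (Suc m)
    have "axis j (of_nat (Suc m)) = axis j (of_nat m) + (axis j 1 :: real ^ 'd)"
      by (simp add: axis_def vec_eq_iff)
    then show ?case using Suc assms by (simp add: add.assoc[symmetric])
  qed
  have int: "f (x + axis j (of_int m)) = f x" for x j m
  proof (cases m rule: int_cases2)
    case (nonneg k)
    then show ?thesis using nat[of x j k] by simp
  next
    case (nonpos k)
    have *: "x + axis j (of_int m) + axis j (of_nat k) = x"
      using nonpos by (simp add: axis_def vec_eq_iff)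
    have "f x = f (x + axis j (of_int m) + axis j (of_nat k))" by (simp only: *)
    also have "\<dots> = f (x + axis j (of_int m))" by (rule nat)
    finally show ?thesis by (rule sym)
  qed
  have "f (x + (\<Sum>j\<in>S. axis j (of_int (n j)))) = f x" if "finite S" for S
    using that
  proof (induction S arbitrary: x rule: finite_induct)
    case (insert j S)
    then show ?case using int by (simp add: add.assoc[symmetric])
  qed simp
  moreover have "(\<chi> j. of_int (n j)) = (\<Sum>j\<in>UNIV. axis j (of_int (n j)) :: real ^ 'd)"
    by (simp add: vec_eq_iff axis_def)
  ultimately show ?thesis by simp
qed

text \<open>A periodic function takes all its values on the unit cube, and the unit cube times a
  compact time interval is compact.\<close>

lemma periodic_continuous_bounded:
  fixes f :: "real ^ 'd \<Rightarrow> real \<Rightarrow> 'b::real_normed_vector"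
  assumes per: "space_periodic f" and cont: "continuous_on (UNIV \<times> {0<..}) (\<lambda>(x, t). f x t)" and "0 < a"
  shows "bounded ((\<lambda>(x, t). f x t) ` (UNIV \<times> {a..b}))"
proof -
  let ?K = "cbox 0 1 \<times> {a..b} :: ((real ^ 'd) \<times> real) set"
  have "compact ((\<lambda>(x, t). f x t) ` ?K)"
    using \<open>0 < a\<close> by (intro compact_continuous_image continuous_on_subset[OF cont] compact_Times) auto
  moreover have "(\<lambda>(x, t). f x t) ` (UNIV \<times> {a..b}) \<subseteq> (\<lambda>(x, t). f x t) ` ?K"
  proof safe
    fix x :: "real ^ 'd" and \<tau> assume \<tau>: "\<tau> \<in> {a..b}"
    define x' where "x' = x + (\<chi> j. of_int (- \<lfloor>x $ j\<rfloor>))"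
    have "f x' \<tau> = f x \<tau>"
      unfolding x'_def using per \<tau> \<open>0 < a\<close>
      by (intro periodic_translate) (auto simp: space_periodic_def)
    moreover have "x' \<in> cbox 0 1"
      by (auto simp: x'_def mem_box_cart) linarith+
    ultimately show "f x \<tau> \<in> (\<lambda>(x, t). f x t) ` ?K"
      using \<tau> by (intro image_eqI[of _ _ "(x', \<tau>)"]) auto
  qed
  ultimately show ?thesis
    by (meson bounded_subset compact_imp_bounded)
qed

section \<open>Symmetry of second derivatives\<close>

text \<open>The mean value theorem is applied first in direction \<open>d\<close>, to the difference of two
  translates of \<open>f\<close>, and then in direction \<open>e\<close>.\<close>

lemma double_difference_mean_value:
  fixes f :: "'a::real_normed_vector \<Rightarrow> real"
  assumes f: "\<And>x. (f has_derivative f' x) (at x)"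
    and g: "\<And>x. ((\<lambda>x. f' x d) has_derivative g' x) (at x)"
    and "0 < r"
  obtains \<theta> \<eta> where "0 < \<theta>" "\<theta> < r" "0 < \<eta>" "\<eta> < r"
    "f (x + r *\<^sub>R e + r *\<^sub>R d) - f (x + r *\<^sub>R d) - f (x + r *\<^sub>R e) + f x
      = r * r * g' (x + \<theta> *\<^sub>R d + \<eta> *\<^sub>R e) e"
proof -
  have "\<exists>\<theta>. 0 < \<theta> \<and> \<theta> < r \<and>
      (f (x + r *\<^sub>R e + r *\<^sub>R d) - f (x + r *\<^sub>R d)) - (f (x + r *\<^sub>R e + 0 *\<^sub>R d) - f (x + 0 *\<^sub>R d))
      = (r - 0) * (f' (x + r *\<^sub>R e + \<theta> *\<^sub>R d) d - f' (x + \<theta> *\<^sub>R d) d)"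
    using \<open>0 < r\<close> by (intro MVT2 DERIV_diff has_real_derivative_along_line f)
  then obtain \<theta> where \<theta>: "0 < \<theta>" "\<theta> < r" and 1:
      "f (x + r *\<^sub>R e + r *\<^sub>R d) - f (x + r *\<^sub>R d) - f (x + r *\<^sub>R e) + f x
      = r * (f' (x + r *\<^sub>R e + \<theta> *\<^sub>R d) d - f' (x + \<theta> *\<^sub>R d) d)"
    by auto
  have "\<exists>\<eta>. 0 < \<eta> \<and> \<eta> < r \<and>
      f' (x + \<theta> *\<^sub>R d + r *\<^sub>R e) d - f' (x + \<theta> *\<^sub>R d + 0 *\<^sub>R e) d = (r - 0) * g' (x + \<theta> *\<^sub>R d + \<eta> *\<^sub>R e) e"
    using \<open>0 < r\<close> by (intro MVT2 has_real_derivative_along_line[where g = "\<lambda>x. f' x d"] g)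
  then obtain \<eta> where "0 < \<eta>" "\<eta> < r"
      "f' (x + r *\<^sub>R e + \<theta> *\<^sub>R d) d - f' (x + \<theta> *\<^sub>R d) d = r * g' (x + \<theta> *\<^sub>R d + \<eta> *\<^sub>R e) e"
    by (auto simp: add_ac)
  with \<theta> 1 show ?thesis by (intro that[of \<theta> \<eta>]) auto
qed

text \<open>The double difference is symmetric in the two directions. It is therefore \<open>r\<^sup>2\<close> times
  a value of either mixed derivative at points that tend to \<open>x\<close> as \<open>r\<close> tends to 0.\<close>

lemma mixed_derivatives_commute_real:
  fixes f :: "'a::real_normed_vector \<Rightarrow> real"
  assumes f: "\<And>x. (f has_derivative f' x) (at x)"
    and g: "\<And>x. ((\<lambda>x. f' x d) has_derivative g' x) (at x)" "isCont (\<lambda>x. g' x e) x"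
    and h: "\<And>x. ((\<lambda>x. f' x e) has_derivative h' x) (at x)" "isCont (\<lambda>x. h' x d) x"
  shows "g' x e = h' x d"
proof -
  define r where "r n = inverse (real (Suc n))" for n
  have r: "0 < r n" for n by (simp add: r_def)
  have "\<exists>\<theta> \<eta> \<theta>' \<eta>'. \<theta> \<in> {0<..<r n} \<and> \<eta> \<in> {0<..<r n} \<and> \<theta>' \<in> {0<..<r n} \<and> \<eta>' \<in> {0<..<r n} \<and>
     g' (x + \<theta> *\<^sub>R d + \<eta> *\<^sub>R e) e = h' (x + \<theta>' *\<^sub>R e + \<eta>' *\<^sub>R d) d" for n
  proof -
    obtain \<theta> \<eta> where 1: "0 < \<theta>" "\<theta> < r n" "0 < \<eta>" "\<eta> < r n"
      "f (x + r n *\<^sub>R e + r n *\<^sub>R d) - f (x + r n *\<^sub>R d) - f (x + r n *\<^sub>R e) + f x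
        = r n * r n * g' (x + \<theta> *\<^sub>R d + \<eta> *\<^sub>R e) e"
      by (rule double_difference_mean_value[OF f g(1) r])
    obtain \<theta>' \<eta>' where 2: "0 < \<theta>'" "\<theta>' < r n" "0 < \<eta>'" "\<eta>' < r n"
      "f (x + r n *\<^sub>R d + r n *\<^sub>R e) - f (x + r n *\<^sub>R e) - f (x + r n *\<^sub>R d) + f x
        = r n * r n * h' (x + \<theta>' *\<^sub>R e + \<eta>' *\<^sub>R d) d"
      by (rule double_difference_mean_value[OF f h(1) r])
    have "r n * r n * g' (x + \<theta> *\<^sub>R d + \<eta> *\<^sub>R e) e = r n * r n * h' (x + \<theta>' *\<^sub>R e + \<eta>' *\<^sub>R d) d"
    proof -
      have "f (x + r n *\<^sub>R e + r n *\<^sub>R d) = f (x + r n *\<^sub>R d + r n *\<^sub>R e)"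
        by (rule arg_cong[where f = f]) (simp add: add_ac)
      then have "f (x + r n *\<^sub>R e + r n *\<^sub>R d) - f (x + r n *\<^sub>R d) - f (x + r n *\<^sub>R e) + f x
          = f (x + r n *\<^sub>R d + r n *\<^sub>R e) - f (x + r n *\<^sub>R e) - f (x + r n *\<^sub>R d) + f x"
        by simp
      then show ?thesis by (simp only: 1(5) 2(5))
    qed
    then have "g' (x + \<theta> *\<^sub>R d + \<eta> *\<^sub>R e) e = h' (x + \<theta>' *\<^sub>R e + \<eta>' *\<^sub>R d) d"
      using r[of n] by simp
    with 1 2 show ?thesis
      by (intro exI[of _ \<theta>] exI[of _ \<eta>] exI[of _ \<theta>'] exI[of _ \<eta>']) simp
  qed
  then obtain \<theta> \<eta> \<theta>' \<eta>' where *: "\<And>n. \<theta> n \<in> {0<..<r n}" "\<And>n. \<eta> n \<in> {0<..<r n}"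
      "\<And>n. \<theta>' n \<in> {0<..<r n}" "\<And>n. \<eta>' n \<in> {0<..<r n}"
      "\<And>n. g' (x + \<theta> n *\<^sub>R d + \<eta> n *\<^sub>R e) e = h' (x + \<theta>' n *\<^sub>R e + \<eta>' n *\<^sub>R d) d"
    by metis
  have lim: "X \<longlonglongrightarrow> 0" if "\<And>n. X n \<in> {0<..<r n}" for X
    by (rule tendsto_sandwich[OF _ _ tendsto_const LIMSEQ_inverse_real_of_nat])
      (use that in \<open>auto simp: r_def intro!: always_eventually less_imp_le\<close>)
  have "(\<lambda>n. x + \<theta> n *\<^sub>R d + \<eta> n *\<^sub>R e) \<longlonglongrightarrow> x + 0 *\<^sub>R d + 0 *\<^sub>R e"
    by (intro tendsto_intros lim *)
  then have "(\<lambda>n. g' (x + \<theta> n *\<^sub>R d + \<eta> n *\<^sub>R e) e) \<longlonglongrightarrow> g' x e"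
    by (intro isCont_tendsto_compose[OF g(2)]) simp
  moreover have "(\<lambda>n. x + \<theta>' n *\<^sub>R e + \<eta>' n *\<^sub>R d) \<longlonglongrightarrow> x + 0 *\<^sub>R e + 0 *\<^sub>R d"
    by (intro tendsto_intros lim *)
  then have "(\<lambda>n. h' (x + \<theta>' n *\<^sub>R e + \<eta>' n *\<^sub>R d) d) \<longlonglongrightarrow> h' x d"
    by (intro isCont_tendsto_compose[OF h(2)]) simp
  ultimately show ?thesis
    unfolding *(5) by (rule LIMSEQ_unique)
qed

lemma mixed_derivatives_commute:
  fixes f :: "'a::real_normed_vector \<Rightarrow> 'b::real_inner"
  assumes f: "\<And>x. (f has_derivative f' x) (at x)"
    and g: "\<And>x. ((\<lambda>x. f' x d) has_derivative g' x) (at x)" "isCont (\<lambda>x. g' x e) x"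
    and h: "\<And>x. ((\<lambda>x. f' x e) has_derivative h' x) (at x)" "isCont (\<lambda>x. h' x d) x"
  shows "g' x e = h' x d"
proof -
  have "b \<bullet> g' x e = b \<bullet> h' x d" for b
    by (rule mixed_derivatives_commute_real[where f = "\<lambda>x. b \<bullet> f x" and f' = "\<lambda>x h. b \<bullet> f' x h"
        and g' = "\<lambda>x h. b \<bullet> g' x h" and h' = "\<lambda>x h. b \<bullet> h' x h"])
      (intro has_derivative_inner_right f g h continuous_intros)+
  then have "\<forall>b. b \<bullet> g' x e = b \<bullet> h' x d" by blast
  then show ?thesis by (rule vector_eq_ldot[THEN iffD1])
qed

section \<open>Periodic functions with continuous parabolic derivatives\<close>

lemma bounded_inner_comp:
  fixes f g :: "'a \<Rightarrow> 'b::real_inner"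
  assumes "bounded (f ` S)" "bounded (g ` S)"
  shows "bounded ((\<lambda>x. f x \<bullet> g x) ` S)"
proof -
  obtain A where A: "\<And>x. x \<in> S \<Longrightarrow> norm (f x) \<le> A" using assms(1) by (auto simp: bounded_iff)
  obtain B where B: "\<And>x. x \<in> S \<Longrightarrow> norm (g x) \<le> B" using assms(2) by (auto simp: bounded_iff)
  have "norm (f x \<bullet> g x) \<le> A * B" if "x \<in> S" for x
  proof -
    have "0 \<le> A" using A[OF that] norm_ge_zero order_trans by blast
    then have "norm (f x) * norm (g x) \<le> A * B"
      using A[OF that] B[OF that] by (intro mult_mono) auto
    then show ?thesis
      using Cauchy_Schwarz_ineq2[of "f x" "g x"] by simp
  qed
  then show ?thesis by (auto simp: bounded_iff)
qed

lemma bounded_sum_comp: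
  fixes f :: "'i \<Rightarrow> 'a \<Rightarrow> 'b::real_normed_vector"
  assumes "\<And>i. i \<in> I \<Longrightarrow> bounded (f i ` S)"
  shows "bounded ((\<lambda>x. \<Sum>i\<in>I. f i x) ` S)"
  using assms
proof (induction I rule: infinite_finite_induct)
  case (insert i I)
  then show ?case by (simp add: bounded_plus_comp)
qed (auto simp: bounded_iff intro!: exI[of _ 0])

lemma bounded_cmult_comp:
  fixes f :: "'a \<Rightarrow> real"
  shows "bounded (f ` S) \<Longrightarrow> bounded ((\<lambda>x. c * f x) ` S)"
  using bounded_scaleR_comp[of f S c] by simp

lemma has_derivative_translate:
  assumes "\<And>z. g (z + e) = g z" and "(g has_derivative D) (at (x + e))"
  shows "(g has_derivative D) (at x)"
proof -
  have "((\<lambda>z. g (z + e)) has_derivative (\<lambda>h. D h)) (at x)"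
    by (rule has_derivative_compose[of "\<lambda>z. z + e" "\<lambda>h. h" x UNIV g D])
      (use assms(2) in \<open>auto intro!: derivative_eq_intros\<close>)
  then show ?thesis by (simp add: assms(1))
qed

lemma partial_translate:
  assumes "\<And>z. g (z + e) = g z"
  shows "partial j g (x + e) = partial j g x"
proof -
  have "g (z + - e) = g z" for z
    using assms[of "z - e"] by simp
  then have "(g has_derivative D) (at (x + e)) \<longleftrightarrow> (g has_derivative D) (at x)" for D
    using has_derivative_translate[of g e D x] has_derivative_translate[of g "- e" D "x + e"] assms
    by auto
  then show ?thesis
    by (simp add: partial_def frechet_derivative_def)
qed

locale periodic_C21 =
  fixes u :: "real ^ 'd \<Rightarrow> real \<Rightarrow> real ^ 'n"
  assumes periodic: "space_periodic u" and C21: "C21 u"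
begin

definition du :: "'d \<Rightarrow> real ^ 'd \<Rightarrow> real \<Rightarrow> real ^ 'n" where
  "du j x t = partial j (\<lambda>z. u z t) x"

definition ddu :: "'d \<Rightarrow> 'd \<Rightarrow> real ^ 'd \<Rightarrow> real \<Rightarrow> real ^ 'n" where
  "ddu k j x t = partial k (\<lambda>z. du j z t) x"

abbreviation Du :: "real \<Rightarrow> real ^ 'd \<Rightarrow> real ^ 'd \<Rightarrow> real ^ 'n" where
  "Du t x \<equiv> frechet_derivative (\<lambda>z. u z t) (at x)"

abbreviation Ddu :: "'d \<Rightarrow> real \<Rightarrow> real ^ 'd \<Rightarrow> real ^ 'd \<Rightarrow> real ^ 'n" where
  "Ddu j t x \<equiv> frechet_derivative (\<lambda>z. du j z t) (at x)"

lemma du_eta: "(\<lambda>z. du j z t) = partial j (\<lambda>z. u z t)"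
  by (simp add: du_def fun_eq_iff)

lemma Du_axis [simp]: "Du t x (axis j 1) = du j x t"
  by (simp add: du_def partial_def)

lemma Ddu_axis [simp]: "Ddu j t x (axis k 1) = ddu k j x t"
  by (simp add: ddu_def partial_def)

lemma u_has_derivative: "0 < t \<Longrightarrow> ((\<lambda>z. u z t) has_derivative Du t x) (at x)"
  using C21 unfolding frechet_derivative_works[symmetric] C21_def by blast

lemma du_has_derivative: "0 < t \<Longrightarrow> ((\<lambda>z. du j z t) has_derivative Ddu j t x) (at x)"
  using C21 unfolding frechet_derivative_works[symmetric] C21_def du_eta by blast

lemma u_has_time_derivative: "0 < t \<Longrightarrow> (u x has_vector_derivative time_deriv u x t) (at t)"
  using C21 unfolding C21_def time_deriv_def by (auto simp: vector_derivative_works)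

lemma jointly_continuous:
  shows "continuous_on (UNIV \<times> {0<..}) (\<lambda>(x, t). u x t)"
    and "continuous_on (UNIV \<times> {0<..}) (\<lambda>(x, t). time_deriv u x t)"
    and "continuous_on (UNIV \<times> {0<..}) (\<lambda>(x, t). du j x t)"
    and "continuous_on (UNIV \<times> {0<..}) (\<lambda>(x, t). ddu k j x t)"
  using C21 unfolding C21_def ddu_def du_eta unfolding du_def by auto

lemma periodic_derivatives:
  shows "space_periodic (time_deriv u)" and du_periodic: "space_periodic (du j)" and "space_periodic (ddu k j)"
proof -
  have per: "u (x + axis j 1) t = u x t" if "0 < t" for x j t
    using periodic that by (auto simp: space_periodic_def)
  show "space_periodic (time_deriv u)"
    unfolding space_periodic_def time_deriv_def
  proof (intro allI impI)
    fix t :: real and x j assume "0 < t"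
    have "\<forall>\<^sub>F \<tau> in nhds t. u (x + axis j 1) \<tau> = u x \<tau>"
      using eventually_nhds_in_open[of "{0<..}" t] \<open>0 < t\<close> by (auto elim!: eventually_mono simp: per)
    then show "vector_derivative (u (x + axis j 1)) (at t) = vector_derivative (u x) (at t)"
      by (intro vector_derivative_cong_eq) auto
  qed
  show du: "space_periodic (du j)" for j
    unfolding space_periodic_def du_def by (auto intro!: partial_translate per)
  show "space_periodic (ddu k j)"
    using du unfolding space_periodic_def ddu_def by (auto intro!: partial_translate)
qed

lemma continuous_in_space:
  fixes f :: "real ^ 'd \<Rightarrow> real \<Rightarrow> 'c::real_normed_vector"
  assumes "continuous_on (UNIV \<times> {0<..}) (\<lambda>(x, t). f x t)" "0 < t"
  shows "continuous_on UNIV (\<lambda>x. f x t)"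
proof -
  have "continuous_on UNIV (\<lambda>x::real ^ 'd. (x, t))"
    by (intro continuous_intros)
  from continuous_on_compose2[OF assms(1) this] show ?thesis
    using assms(2) by auto
qed

lemma tendsto_in_time:
  fixes f :: "real ^ 'd \<Rightarrow> real \<Rightarrow> 'c::real_normed_vector"
  assumes "continuous_on (UNIV \<times> {0<..}) (\<lambda>(x, t). f x t)" "0 < t"
  shows "((\<lambda>\<tau>. f x \<tau>) \<longlongrightarrow> f x t) (at t)"
proof -
  have "continuous_on {0<..} (\<lambda>\<tau>. f x \<tau>)"
  proof -
    have "continuous_on {0<..} (\<lambda>\<tau>::real. (x, \<tau>))"
      by (intro continuous_intros)
    from continuous_on_compose2[OF assms(1) this] show ?thesis
      by auto
  qed
  then show ?thesis
    using \<open>0 < t\<close> by (auto simp: continuous_on_eq_continuous_at isCont_def)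
qed

lemma bounded_slab:
  assumes "0 < a"
  shows "bounded ((\<lambda>(x, t). u x t) ` (UNIV \<times> {a..b}))"
    and "bounded ((\<lambda>(x, t). time_deriv u x t) ` (UNIV \<times> {a..b}))"
    and "bounded ((\<lambda>(x, t). du j x t) ` (UNIV \<times> {a..b}))"
    and "bounded ((\<lambda>(x, t). ddu k j x t) ` (UNIV \<times> {a..b}))"
  by (rule periodic_continuous_bounded[OF _ _ assms], rule periodic periodic_derivatives, rule jointly_continuous)+

lemma ddu_commute:
  assumes "0 < t"
  shows "ddu k j x t = ddu j k x t"
proof -
  have cont: "isCont (\<lambda>x. ddu k j x t) x" for k j
    using continuous_in_space[OF jointly_continuous(4) assms] by (simp add: continuous_on_eq_continuous_at)
  have "Ddu j t x (axis k 1) = Ddu k t x (axis j 1)"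
    by (rule mixed_derivatives_commute[where f = "\<lambda>z. u z t" and f' = "Du t"])
      (use assms cont in \<open>simp_all add: u_has_derivative du_has_derivative\<close>)
  then show ?thesis by simp
qed

end

section \<open>Pointwise identity and derivatives of the kernel\<close>

text \<open>The completion of the square behind the monotonicity formula, at one point and divided by
  the kernel. Here \<open>a = (x - y) / (2 (s - t))\<close> and \<open>b = 1 / (2 (s - t))\<close>, so that the gradient and the
  Hessian of the kernel are \<open>- a\<close> and \<open>a a\<^sup>T - b I\<close> times the kernel, and \<open>U\<close> stands for the time
  derivative of the solution. The first two lines come from the derivative of the weighted energy,
  except for a summand \<open>- b e\<close>; the other two come from integrations by parts. The products
  \<open>ddu k j \<bullet> du j\<close> cancel by symmetry, and the flow equation turns the remaining cross terms into
  a square.\<close>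

lemma monotonicity_pointwise_algebra:
  fixes du :: "'d::finite \<Rightarrow> 'b::real_inner" and ddu :: "'d \<Rightarrow> 'd \<Rightarrow> 'b" and a :: "'d \<Rightarrow> real" and U G :: 'b
  assumes sym: "\<And>j k. ddu k j = ddu j k" and eq: "\<epsilon> *\<^sub>R U = \<epsilon> *\<^sub>R (\<Sum>j\<in>UNIV. ddu j j) - G"
    and e: "e = \<epsilon> / 2 * (\<Sum>j\<in>UNIV. du j \<bullet> du j) + f"
  shows "(real CARD('d) * b - (\<Sum>j\<in>UNIV. a j * a j)) * e + G \<bullet> U
      - \<epsilon> * (\<Sum>j\<in>UNIV. - a j * (U \<bullet> du j) + U \<bullet> ddu j j)
      + (\<Sum>k\<in>UNIV. (a k * a k - b) * e - a k * (\<epsilon> * (\<Sum>j\<in>UNIV. ddu k j \<bullet> du j) + G \<bullet> du k))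
      - \<epsilon> * (\<Sum>j\<in>UNIV. \<Sum>k\<in>UNIV. (a j * a k - (if j = k then b else 0)) * (du k \<bullet> du j)
            - a k * (ddu j k \<bullet> du j + du k \<bullet> ddu j j))
    = \<epsilon> * b * (\<Sum>j\<in>UNIV. du j \<bullet> du j)
      - \<epsilon> * ((U - (\<Sum>k\<in>UNIV. a k *\<^sub>R du k)) \<bullet> (U - (\<Sum>k\<in>UNIV. a k *\<^sub>R du k)))"
proof -
  define X where "X = (\<Sum>k\<in>UNIV. a k *\<^sub>R du k)"
  define L where "L = (\<Sum>j\<in>UNIV. ddu j j)"
  define Y where "Y = (\<Sum>j\<in>UNIV. \<Sum>k\<in>UNIV. a k * (ddu j k \<bullet> du j))"
  have G: "G = \<epsilon> *\<^sub>R (L - U)"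
    using eq by (simp add: L_def algebra_simps)
  have 1: "(\<Sum>k\<in>UNIV. (a k * a k - b) * e - a k * (\<epsilon> * (\<Sum>j\<in>UNIV. ddu k j \<bullet> du j) + G \<bullet> du k))
      = ((\<Sum>j\<in>UNIV. a j * a j) - real CARD('d) * b) * e - \<epsilon> * Y - G \<bullet> X"
  proof -
    have "Y = (\<Sum>k\<in>UNIV. \<Sum>j\<in>UNIV. a k * (ddu k j \<bullet> du j))"
      unfolding Y_def by (subst sum.swap) (simp add: sym)
    then have "\<epsilon> * Y = (\<Sum>k\<in>UNIV. a k * (\<epsilon> * (\<Sum>j\<in>UNIV. ddu k j \<bullet> du j)))"
      by (simp add: sum_distrib_left mult_ac)
    moreover have "G \<bullet> X = (\<Sum>k\<in>UNIV. a k * (G \<bullet> du k))"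
      by (simp add: X_def inner_sum_right)
    moreover have "((\<Sum>j\<in>UNIV. a j * a j) - real CARD('d) * b) * e = (\<Sum>k\<in>UNIV. (a k * a k - b) * e)"
      by (simp add: sum_distrib_right[symmetric] sum_subtractf)
    ultimately show ?thesis
      by (simp add: sum_subtractf sum.distrib distrib_left)
  qed
  have 2: "(\<Sum>j\<in>UNIV. - a j * (U \<bullet> du j) + U \<bullet> ddu j j) = - (U \<bullet> X) + U \<bullet> L"
    by (simp add: X_def L_def inner_sum_right sum.distrib sum_negf sum_subtractf)
  have 3: "(\<Sum>j\<in>UNIV. \<Sum>k\<in>UNIV. (a j * a k - (if j = k then b else 0)) * (du k \<bullet> du j)
            - a k * (ddu j k \<bullet> du j + du k \<bullet> ddu j j))
      = X \<bullet> X - b * (\<Sum>j\<in>UNIV. du j \<bullet> du j) - Y - X \<bullet> L"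
  proof -
    have XX: "X \<bullet> X = (\<Sum>j\<in>UNIV. \<Sum>k\<in>UNIV. a j * a k * (du k \<bullet> du j))"
      by (simp add: X_def inner_sum_left inner_sum_right mult_ac inner_commute)
    have XL: "X \<bullet> L = (\<Sum>j\<in>UNIV. \<Sum>k\<in>UNIV. a k * (du k \<bullet> ddu j j))"
      unfolding X_def L_def inner_sum_right by (simp add: inner_sum_left)
    have D: "(\<Sum>j\<in>UNIV. \<Sum>k\<in>UNIV. (if j = k then b else 0) * (du k \<bullet> du j)) = b * (\<Sum>j\<in>UNIV. du j \<bullet> du j)"
    proof -
      have "(\<Sum>k\<in>UNIV. (if j = k then b else 0) * (du k \<bullet> du j)) = b * (du j \<bullet> du j)" for j
        by (subst sum.cong[OF refl, of _ _ "\<lambda>k. if j = k then b * (du k \<bullet> du j) else 0"]) auto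
      then show ?thesis by (simp add: sum_distrib_left)
    qed
    have "(\<Sum>j\<in>UNIV. \<Sum>k\<in>UNIV. (a j * a k - (if j = k then b else 0)) * (du k \<bullet> du j)
            - a k * (ddu j k \<bullet> du j + du k \<bullet> ddu j j))
      = (\<Sum>j\<in>UNIV. \<Sum>k\<in>UNIV. a j * a k * (du k \<bullet> du j) - (if j = k then b else 0) * (du k \<bullet> du j)
            - a k * (ddu j k \<bullet> du j) - a k * (du k \<bullet> ddu j j))"
      by (intro sum.cong refl) (simp only: left_diff_distrib distrib_left diff_diff_eq)
    also have "\<dots> = X \<bullet> X - b * (\<Sum>j\<in>UNIV. du j \<bullet> du j) - Y - X \<bullet> L"
      unfolding XX XL D[symmetric] Y_def by (simp only: sum_subtractf)
    finally show ?thesis .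
  qed
  show ?thesis
    unfolding 1 2 3 X_def[symmetric] unfolding G
    by (simp add: inner_diff_left inner_diff_right inner_commute algebra_simps)
qed

text \<open>The partial derivatives of the kernel are written with \<open>(x - y) / (2 (s - t))\<close> kept as a
  unit, which is the vector \<open>a\<close> of the preceding identity.\<close>

definition kernel_gradient :: "real ^ 'd \<Rightarrow> real \<Rightarrow> real \<Rightarrow> 'd \<Rightarrow> real ^ 'd \<Rightarrow> real" where
  "kernel_gradient y s t k x = - ((x - y) $ k / (2 * (s - t))) * inverse_heat_kernel y s x t"

definition kernel_hessian :: "real ^ 'd \<Rightarrow> real \<Rightarrow> real \<Rightarrow> 'd \<Rightarrow> 'd \<Rightarrow> real ^ 'd \<Rightarrow> real" where
  "kernel_hessian y s t j k x =
    ((x - y) $ j / (2 * (s - t)) * ((x - y) $ k / (2 * (s - t))) - (if j = k then 1 / (2 * (s - t)) else 0))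
      * inverse_heat_kernel y s x t"

lemma kernel_has_gradient:
  obtains K' where "\<And>x. ((\<lambda>x. inverse_heat_kernel y s x t) has_derivative K' x) (at x)"
    and "\<And>x j. K' x (axis j 1) = kernel_gradient y s t j x"
  using inverse_heat_kernel_space_derivative[of y s t]
  by (rule that) (simp only: kernel_gradient_def inner_axis inner_real_def mult_1_right minus_divide_left)

lemma kernel_gradient_has_derivative:
  fixes y :: "real ^ 'd"
  obtains K'' where "\<And>x. (kernel_gradient y s t k has_derivative K'' x) (at x)"
    and "\<And>x j. K'' x (axis j 1) = kernel_hessian y s t j k x"
proof -
  let ?K = "\<lambda>x. inverse_heat_kernel y s x t"
  let ?D = "\<lambda>x h. - ((x - y) $ k / (2 * (s - t))) * (- ((x - y) \<bullet> h) / (2 * (s - t)) * ?K x)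
        + - (h $ k / (2 * (s - t))) * ?K x"
  have "(kernel_gradient y s t k has_derivative ?D x) (at x)" for x
  proof -
    have "((\<lambda>x. x - y) has_derivative (\<lambda>h. h)) (at x)"
      by (auto intro!: derivative_eq_intros)
    then have "((\<lambda>x. (x - y) $ k) has_derivative (\<lambda>h. h $ k)) (at x)"
      by (rule bounded_linear.has_derivative[OF bounded_linear_vec_nth])
    then have "((\<lambda>x. - ((x - y) $ k / (2 * (s - t)))) has_derivative (\<lambda>h. - (h $ k / (2 * (s - t))))) (at x)"
      unfolding divide_inverse by (intro has_derivative_minus has_derivative_mult_left)
    then show ?thesis
      unfolding kernel_gradient_def[abs_def]
      by (rule has_derivative_mult[OF _ inverse_heat_kernel_space_derivative])
  qed
  moreover have "?D x (axis j 1) = kernel_hessian y s t j k x" for x j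
  proof -
    define b where "b = inverse (2 * (s - t))"
    have "(axis j 1 :: real ^ 'd) $ k = (if j = k then 1 else 0)"
      by (simp add: axis_def eq_commute)
    then show ?thesis
      unfolding kernel_hessian_def inner_axis inner_real_def divide_inverse b_def[symmetric]
      by (simp add: algebra_simps)
  qed
  ultimately show ?thesis
    by (rule that)
qed

lemma gaussian_decay_kernel_gradient:
  assumes "t < s"
  shows "gaussian_decay y (kernel_gradient y s t k)"
proof -
  have "\<bar>kernel_gradient y s t k x\<bar>
      \<le> \<bar>1 / (2 * (s - t)) * ((1 + (norm (x - y))\<^sup>2) * inverse_heat_kernel y s x t)\<bar>" for x
  proof -
    have "\<bar>(x - y) $ k\<bar> \<le> norm (x - y)" by (rule component_le_norm_cart)
    also have "\<dots> \<le> 1 + (norm (x - y))\<^sup>2"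
      using zero_le_power2[of "norm (x - y) - 1"] by (simp add: power2_eq_square algebra_simps)
        (smt (verit) norm_ge_zero zero_le_mult_iff)
    finally show ?thesis
      using assms inverse_heat_kernel_nonneg[of y s x t]
      by (simp add: kernel_gradient_def abs_mult divide_right_mono mult_right_mono)
  qed
  then show ?thesis
    by (rule gaussian_decay_le[OF gaussian_decay_cmult[OF gaussian_decay_mult_square[OF inverse_heat_kernel_decay[OF assms]]]])
qed

lemma gaussian_decay_kernel_hessian:
  assumes "t < s"
  shows "gaussian_decay y (kernel_hessian y s t j k)"
proof -
  define b where "b = 1 / (2 * (s - t))"
  have b: "0 < b" using assms by (simp add: b_def)
  have "\<bar>kernel_hessian y s t j k x\<bar>
      \<le> \<bar>(b * b + b) * ((1 + (norm (x - y))\<^sup>2) * inverse_heat_kernel y s x t)\<bar>" for x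
  proof -
    define r where "r = (norm (x - y))\<^sup>2"
    have r: "0 \<le> r" by (simp add: r_def)
    have "\<bar>(x - y) $ j\<bar> * \<bar>(x - y) $ k\<bar> \<le> r"
      unfolding r_def power2_eq_square by (intro mult_mono component_le_norm_cart) auto
    then have 1: "b * b * (\<bar>(x - y) $ j\<bar> * \<bar>(x - y) $ k\<bar>) \<le> b * b * r"
      using b by (intro mult_left_mono) auto
    have "\<bar>(x - y) $ j * b * ((x - y) $ k * b) - (if j = k then b else 0)\<bar>
        \<le> \<bar>(x - y) $ j * b * ((x - y) $ k * b)\<bar> + b"
      using b by (auto intro: order_trans[OF abs_triangle_ineq4])
    also have "\<bar>(x - y) $ j * b * ((x - y) $ k * b)\<bar> = b * b * (\<bar>(x - y) $ j\<bar> * \<bar>(x - y) $ k\<bar>)"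
      using b by (simp add: abs_mult mult_ac)
    also have "\<dots> + b \<le> b * b * r + b" using 1 by simp
    also have "\<dots> \<le> (b * b + b) * (1 + r)" using b r by (simp add: algebra_simps)
    finally have 2: "\<bar>(x - y) $ j * b * ((x - y) $ k * b) - (if j = k then b else 0)\<bar> \<le> (b * b + b) * (1 + r)" .
    have "kernel_hessian y s t j k x
        = ((x - y) $ j * b * ((x - y) $ k * b) - (if j = k then b else 0)) * inverse_heat_kernel y s x t"
      by (simp only: kernel_hessian_def b_def times_divide_eq_right mult_1_right)
    then have "\<bar>kernel_hessian y s t j k x\<bar> \<le> (b * b + b) * (1 + r) * inverse_heat_kernel y s x t"
      using mult_right_mono[OF 2 inverse_heat_kernel_nonneg[of y s x t]]
      by (simp add: abs_mult inverse_heat_kernel_nonneg)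
    also have "\<dots> \<le> \<bar>(b * b + b) * ((1 + (norm (x - y))\<^sup>2) * inverse_heat_kernel y s x t)\<bar>"
      unfolding r_def by (simp only: mult.assoc abs_ge_self)
    finally show ?thesis .
  qed
  then show ?thesis
    by (rule gaussian_decay_le[OF gaussian_decay_cmult[OF gaussian_decay_mult_square[OF inverse_heat_kernel_decay[OF assms]]]])
qed

lemma inverse_heat_kernel_measurable [measurable]:
  "(\<lambda>x. inverse_heat_kernel y s x t) \<in> borel_measurable borel"
  by (intro borel_measurable_continuous_onI continuous_at_imp_continuous_on ballI
      has_derivative_continuous[OF inverse_heat_kernel_space_derivative])

lemma kernel_gradient_measurable [measurable]: "kernel_gradient y s t k \<in> borel_measurable borel"
proof -
  obtain K'' where "\<And>x. (kernel_gradient y s t k has_derivative K'' x) (at x)"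
    by (rule kernel_gradient_has_derivative[of y s t k]) blast
  then show ?thesis
    by (intro borel_measurable_continuous_onI continuous_at_imp_continuous_on ballI has_derivative_continuous)
qed

section \<open>Gradient flows weighted with the kernel\<close>

text \<open>The flow is the gradient flow of the integral of \<open>\<epsilon> / 2 |\<nabla>u|\<^sup>2 + F u\<close>, with the time
  derivative multiplied by \<open>\<epsilon>\<close>; the Laplacian is written as the trace of \<open>ddu\<close>.\<close>

locale gradient_flow = periodic_C21 u
  for u :: "real ^ 'd \<Rightarrow> real \<Rightarrow> real ^ 'n" +
  fixes \<epsilon> :: real and F :: "real ^ 'n \<Rightarrow> real" and G :: "real ^ 'n \<Rightarrow> real ^ 'n"
  assumes \<epsilon>: "0 < \<epsilon>"
    and F_has_derivative: "\<And>v. (F has_derivative (\<lambda>h. G v \<bullet> h)) (at v)"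
    and flow: "\<And>x t. 0 < t \<Longrightarrow>
      \<epsilon> *\<^sub>R time_deriv u x t = \<epsilon> *\<^sub>R (\<Sum>j\<in>UNIV. ddu j j x t) - G (u x t)"
begin

definition energy :: "real ^ 'd \<Rightarrow> real \<Rightarrow> real" where
  "energy x t = \<epsilon> / 2 * (\<Sum>j\<in>UNIV. du j x t \<bullet> du j x t) + F (u x t)"

lemma F_continuous: "continuous_on UNIV F"
  by (meson F_has_derivative continuous_at_imp_continuous_on has_derivative_continuous)

lemma Fu_continuous: "continuous_on (UNIV \<times> {0<..}) (\<lambda>(x, t). F (u x t))"
  using continuous_on_compose2[OF F_continuous jointly_continuous(1)] by (simp add: split_beta)

lemma energy_continuous: "continuous_on (UNIV \<times> {0<..}) (\<lambda>(x, t). energy x t)"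
  using Fu_continuous jointly_continuous(3) unfolding energy_def split_beta
  by (intro continuous_intros)

lemma G_eq: "0 < t \<Longrightarrow> G (u x t) = \<epsilon> *\<^sub>R (\<Sum>j\<in>UNIV. ddu j j x t) - \<epsilon> *\<^sub>R time_deriv u x t"
  using flow[of t x] by (simp add: algebra_simps)

text \<open>The flow equation expresses \<open>G \<circ> u\<close> by derivatives of \<open>u\<close>, and these
  are bounded.\<close>

lemma bounded_slab_G:
  assumes "0 < a"
  shows "bounded ((\<lambda>(x, t). G (u x t)) ` (UNIV \<times> {a..b}))"
proof -
  have "bounded ((\<lambda>z. \<epsilon> *\<^sub>R (\<Sum>j\<in>UNIV. (\<lambda>(x, t). ddu j j x t) z) - \<epsilon> *\<^sub>R (\<lambda>(x, t). time_deriv u x t) z)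
      ` (UNIV \<times> {a..b}))"
    by (intro bounded_minus_comp bounded_scaleR_comp bounded_sum_comp bounded_slab assms)
  also have "(\<lambda>z. \<epsilon> *\<^sub>R (\<Sum>j\<in>UNIV. (\<lambda>(x, t). ddu j j x t) z) - \<epsilon> *\<^sub>R (\<lambda>(x, t). time_deriv u x t) z)
      ` (UNIV \<times> {a..b}) = (\<lambda>(x, t). G (u x t)) ` (UNIV \<times> {a..b})"
    using assms by (intro image_cong) (auto simp: G_eq)
  finally show ?thesis .
qed

lemma bounded_slab_energy:
  assumes "0 < a"
  shows "bounded ((\<lambda>(x, t). energy x t) ` (UNIV \<times> {a..b}))"
proof -
  have "space_periodic (\<lambda>x t. energy x t)"
    using periodic du_periodic by (simp add: space_periodic_def energy_def)
  then show ?thesis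
    by (rule periodic_continuous_bounded[OF _ energy_continuous assms])
qed

lemma Fu_has_space_derivative:
  "0 < t \<Longrightarrow> ((\<lambda>z. F (u z t)) has_derivative (\<lambda>h. G (u x t) \<bullet> Du t x h)) (at x)"
  by (rule has_derivative_compose[OF u_has_derivative F_has_derivative])

lemma Fu_has_time_derivative:
  assumes "0 < t"
  shows "((\<lambda>\<tau>. F (u x \<tau>)) has_real_derivative G (u x t) \<bullet> time_deriv u x t) (at t)"
  using has_derivative_compose[OF u_has_time_derivative[OF assms, of x, unfolded has_vector_derivative_def] F_has_derivative]
  by (simp add: has_field_derivative_def mult_commute_abs)

lemma energy_has_space_derivative:
  assumes "0 < t"
  shows "((\<lambda>z. energy z t) has_derivative
    (\<lambda>h. \<epsilon> * (\<Sum>j\<in>UNIV. Ddu j t x h \<bullet> du j x t) + G (u x t) \<bullet> Du t x h)) (at x)"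
proof -
  have "((\<lambda>z. energy z t) has_derivative
    (\<lambda>h. \<epsilon> / 2 * (\<Sum>j\<in>UNIV. du j x t \<bullet> Ddu j t x h + Ddu j t x h \<bullet> du j x t) + G (u x t) \<bullet> Du t x h)) (at x)"
    unfolding energy_def
    by (intro has_derivative_add has_derivative_mult_right has_derivative_sum has_derivative_inner
        du_has_derivative Fu_has_space_derivative assms)
  then show ?thesis
    by (rule has_derivative_eq_rhs) (simp add: fun_eq_iff inner_commute sum_distrib_left)
qed

lemma bounded_slice:
  fixes f :: "real ^ 'd \<Rightarrow> real \<Rightarrow> 'c::real_normed_vector"
  assumes "bounded ((\<lambda>(x, t). f x t) ` (UNIV \<times> {t..t}))"
  shows "bounded (range (\<lambda>x. f x t))"
proof -
  have "UNIV \<times> {t..t} = range (\<lambda>x :: real ^ 'd. (x, t))" by (auto simp: image_iff)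
  then show ?thesis using assms by (simp add: image_image)
qed

lemma kernel_weighted_integrable:
  fixes f :: "real ^ 'd \<Rightarrow> real \<Rightarrow> real"
  assumes "space_periodic f" and cont: "continuous_on (UNIV \<times> {0<..}) (\<lambda>(x, t). f x t)" and t: "0 < t" "t < s"
  shows "integrable lborel (\<lambda>x. inverse_heat_kernel y s x t * f x t)"
proof -
  obtain B where B: "\<And>x. \<bar>f x t\<bar> \<le> B"
    using bounded_slice[OF periodic_continuous_bounded[OF assms(1,2,3)]] by (auto simp: bounded_iff)
  have [measurable]: "(\<lambda>x. f x t) \<in> borel_measurable borel"
    by (intro borel_measurable_continuous_onI continuous_in_space[OF cont t(1)])
  show ?thesis
    by (rule gaussian_decay_integrable[OF gaussian_decay_mult_bounded[OF inverse_heat_kernel_decay[OF t(2)] B]])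
      measurable
qed

lemma kernel_weighted_energy_integrable:
  assumes "0 < t" "t < s"
  shows "integrable lborel (\<lambda>x. inverse_heat_kernel y s x t * energy x t)"
  using periodic du_periodic
  by (intro kernel_weighted_integrable[OF _ energy_continuous assms]) (simp add: space_periodic_def energy_def)

lemma kernel_weighted_discrepancy_integrable:
  assumes "0 < t" "t < s"
  shows "integrable lborel (\<lambda>x. inverse_heat_kernel y s x t
      * (\<epsilon> / 2 * (\<Sum>j\<in>UNIV. du j x t \<bullet> du j x t) - F (u x t)))"
proof (rule kernel_weighted_integrable[OF _ _ assms])
  show "space_periodic (\<lambda>x t. \<epsilon> / 2 * (\<Sum>j\<in>UNIV. du j x t \<bullet> du j x t) - F (u x t))"
    using periodic du_periodic by (simp add: space_periodic_def)
  show "continuous_on (UNIV \<times> {0<..}) (\<lambda>(x, t). \<epsilon> / 2 * (\<Sum>j\<in>UNIV. du j x t \<bullet> du j x t) - F (u x t))"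
    using Fu_continuous jointly_continuous(3) unfolding split_beta by (intro continuous_intros)
qed

text \<open>The integrand of the derivative of the weighted energy. Formally this derivative has
  the integrand \<open>\<partial>\<^sub>t K e + K (\<epsilon> \<nabla>u \<bullet> \<partial>\<^sub>t\<nabla>u + G \<bullet> \<partial>\<^sub>t u)\<close>; the mixed derivative \<open>\<partial>\<^sub>t\<nabla>u\<close>,
  which need not exist, has been removed by an integration by parts in space.\<close>

definition weighted_energy_rate :: "real ^ 'd \<Rightarrow> real \<Rightarrow> real \<Rightarrow> real ^ 'd \<Rightarrow> real" where
  "weighted_energy_rate y s t x =
     ((real CARD('d) - 1) / (2 * (s - t)) - (norm (x - y))\<^sup>2 / (4 * (s - t)\<^sup>2))
       * inverse_heat_kernel y s x t * energy x t
     + inverse_heat_kernel y s x t * (G (u x t) \<bullet> time_deriv u x t)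
     - \<epsilon> * (\<Sum>j\<in>UNIV. kernel_gradient y s t j x * (time_deriv u x t \<bullet> du j x t)
         + inverse_heat_kernel y s x t * (time_deriv u x t \<bullet> ddu j j x t))"

text \<open>With \<open>w = u(\<tau>) - u(t)\<close> and \<open>z\<^sub>j = du j (\<tau>) + du j (t)\<close>, the difference of the
  squared gradients is \<open>\<Sum>\<^sub>j \<partial>\<^sub>j w \<bullet> z\<^sub>j\<close>. Integration by parts moves the derivative from \<open>w\<close> to
  \<open>K z\<^sub>j\<close>. What remains is linear in \<open>w\<close>, so that division by \<open>\<tau> - t\<close> only needs the time derivative
  of \<open>u\<close> itself.\<close>

lemma weighted_gradient_difference:
  fixes y :: "real ^ 'd" and s t \<tau> :: real
  assumes t: "0 < t" "t < s" and \<tau>: "0 < \<tau>"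
  defines "V \<equiv> \<lambda>j x. kernel_gradient y s t j x * ((u x \<tau> - u x t) \<bullet> (du j x \<tau> + du j x t))
      + inverse_heat_kernel y s x t * ((u x \<tau> - u x t) \<bullet> (ddu j j x \<tau> + ddu j j x t)
        + (du j x \<tau> - du j x t) \<bullet> (du j x \<tau> + du j x t))"
  shows "integrable lborel (V j)" and "(\<integral>x. V j x \<partial>lborel) = 0"
proof -
  obtain K' where K': "\<And>x. ((\<lambda>x. inverse_heat_kernel y s x t) has_derivative K' x) (at x)"
    "\<And>x j. K' x (axis j 1) = kernel_gradient y s t j x"
    by (rule kernel_has_gradient[of y s t]) blast
  let ?f = "\<lambda>x. (u x \<tau> - u x t) \<bullet> (du j x \<tau> + du j x t)"
  let ?f' = "\<lambda>x h. (u x \<tau> - u x t) \<bullet> (Ddu j \<tau> x h + Ddu j t x h) + (Du \<tau> x h - Du t x h) \<bullet> (du j x \<tau> + du j x t)"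
  have d: "(?f has_derivative ?f' x) (at x)" for x
    by (intro has_derivative_inner has_derivative_add has_derivative_diff u_has_derivative du_has_derivative t \<tau>)
  note bounded = bounded_slice[OF bounded_slab(1)] bounded_slice[OF bounded_slab(3)] bounded_slice[OF bounded_slab(4)]
  have b: "bounded (range ?f)" "bounded (range (\<lambda>x. ?f' x (axis j 1)))"
    unfolding Du_axis Ddu_axis
    by (intro bounded_plus_comp bounded_minus_comp bounded_inner_comp bounded t \<tau>)+
  have dec: "gaussian_decay y (\<lambda>x. K' x (axis j 1))"
    unfolding K'(2) by (rule gaussian_decay_kernel_gradient[OF t(2)])
  note W = integral_weighted_derivative_eq_0[where P' = K' and e = "axis j 1" and f = ?f and f' = ?f',
      OF K'(1) inverse_heat_kernel_decay[OF t(2)] dec d b, unfolded K'(2) Du_axis Ddu_axis]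
  show "integrable lborel (V j)" "(\<integral>x. V j x \<partial>lborel) = 0"
    unfolding V_def by (rule W)+
qed

text \<open>The sum of two integrations by parts. The first line is the divergence of the energy
  density times the gradient of the kernel; the rest is \<open>- \<epsilon>\<close> times the divergence of the
  vector field with the components \<open>\<Sum>\<^sub>k \<partial>\<^sub>k K (\<partial>\<^sub>k u \<bullet> \<partial>\<^sub>j u)\<close>. Together they evaluate the integral of
  \<open>(\<epsilon> \<Delta>u - G) \<bullet> (\<nabla>K \<bullet> \<nabla>)u\<close> in terms of the Hessian of the kernel.\<close>

lemma stress_identity:
  fixes y :: "real ^ 'd" and s t :: real
  assumes t: "0 < t" "t < s"
  defines "R \<equiv> \<lambda>x. (\<Sum>k\<in>UNIV. kernel_hessian y s t k k x * energy x t
        + kernel_gradient y s t k x * (\<epsilon> * (\<Sum>j\<in>UNIV. ddu k j x t \<bullet> du j x t) + G (u x t) \<bullet> du k x t))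
      - \<epsilon> * (\<Sum>j\<in>UNIV. \<Sum>k\<in>UNIV. kernel_hessian y s t j k x * (du k x t \<bullet> du j x t)
        + kernel_gradient y s t k x * (du k x t \<bullet> ddu j j x t + ddu j k x t \<bullet> du j x t))"
  shows "integrable lborel R" "(\<integral>x. R x \<partial>lborel) = 0"
proof -
  note bounded = bounded_slice[OF bounded_slab(3)[OF t(1)]] bounded_slice[OF bounded_slab(4)[OF t(1)]]
    bounded_slice[OF bounded_slab_G[OF t(1)]] bounded_slice[OF bounded_slab_energy[OF t(1)]]
  have 1: "integrable lborel (\<lambda>x. kernel_hessian y s t k k x * energy x t
        + kernel_gradient y s t k x * (\<epsilon> * (\<Sum>j\<in>UNIV. ddu k j x t \<bullet> du j x t) + G (u x t) \<bullet> du k x t))"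
    "(\<integral>x. kernel_hessian y s t k k x * energy x t
        + kernel_gradient y s t k x * (\<epsilon> * (\<Sum>j\<in>UNIV. ddu k j x t \<bullet> du j x t) + G (u x t) \<bullet> du k x t) \<partial>lborel) = 0"
    for k
  proof -
    obtain K'' where K'': "\<And>x. (kernel_gradient y s t k has_derivative K'' x) (at x)"
      "\<And>x j. K'' x (axis j 1) = kernel_hessian y s t j k x"
      by (rule kernel_gradient_has_derivative[of y s t k]) blast
    have dec: "gaussian_decay y (\<lambda>x. K'' x (axis k 1))"
      unfolding K''(2) by (rule gaussian_decay_kernel_hessian[OF t(2)])
    have b: "bounded (range (\<lambda>x. \<epsilon> * (\<Sum>j\<in>UNIV. Ddu j t x (axis k 1) \<bullet> du j x t) + G (u x t) \<bullet> Du t x (axis k 1)))"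
      unfolding Du_axis Ddu_axis
      by (intro bounded_plus_comp bounded_cmult_comp bounded_sum_comp bounded_inner_comp bounded)
    show "integrable lborel (\<lambda>x. kernel_hessian y s t k k x * energy x t
        + kernel_gradient y s t k x * (\<epsilon> * (\<Sum>j\<in>UNIV. ddu k j x t \<bullet> du j x t) + G (u x t) \<bullet> du k x t))"
      "(\<integral>x. kernel_hessian y s t k k x * energy x t
        + kernel_gradient y s t k x * (\<epsilon> * (\<Sum>j\<in>UNIV. ddu k j x t \<bullet> du j x t) + G (u x t) \<bullet> du k x t) \<partial>lborel) = 0"
      by (rule integral_weighted_derivative_eq_0[where P' = K'' and e = "axis k 1" and f = "\<lambda>z. energy z t"
            and f' = "\<lambda>x h. \<epsilon> * (\<Sum>j\<in>UNIV. Ddu j t x h \<bullet> du j x t) + G (u x t) \<bullet> Du t x h",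
            OF K''(1) gaussian_decay_kernel_gradient[OF t(2)] dec energy_has_space_derivative[OF t(1)] bounded(4) b,
            unfolded K''(2) Du_axis Ddu_axis])+
  qed
  have 2: "integrable lborel (\<lambda>x. kernel_hessian y s t j k x * (du k x t \<bullet> du j x t)
        + kernel_gradient y s t k x * (du k x t \<bullet> ddu j j x t + ddu j k x t \<bullet> du j x t))"
    "(\<integral>x. kernel_hessian y s t j k x * (du k x t \<bullet> du j x t)
        + kernel_gradient y s t k x * (du k x t \<bullet> ddu j j x t + ddu j k x t \<bullet> du j x t) \<partial>lborel) = 0"
    for j k
  proof -
    obtain K'' where K'': "\<And>x. (kernel_gradient y s t k has_derivative K'' x) (at x)"
      "\<And>x j. K'' x (axis j 1) = kernel_hessian y s t j k x"
      by (rule kernel_gradient_has_derivative[of y s t k]) blast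
    have dec: "gaussian_decay y (\<lambda>x. K'' x (axis j 1))"
      unfolding K''(2) by (rule gaussian_decay_kernel_hessian[OF t(2)])
    have d: "((\<lambda>x. du k x t \<bullet> du j x t) has_derivative (\<lambda>h. du k x t \<bullet> Ddu j t x h + Ddu k t x h \<bullet> du j x t)) (at x)" for x
      by (intro has_derivative_inner du_has_derivative t)
    have b: "bounded (range (\<lambda>x. du k x t \<bullet> du j x t))"
      "bounded (range (\<lambda>x. du k x t \<bullet> Ddu j t x (axis j 1) + Ddu k t x (axis j 1) \<bullet> du j x t))"
      unfolding Ddu_axis by (intro bounded_plus_comp bounded_inner_comp bounded)+
    show "integrable lborel (\<lambda>x. kernel_hessian y s t j k x * (du k x t \<bullet> du j x t)
        + kernel_gradient y s t k x * (du k x t \<bullet> ddu j j x t + ddu j k x t \<bullet> du j x t))"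
      "(\<integral>x. kernel_hessian y s t j k x * (du k x t \<bullet> du j x t)
        + kernel_gradient y s t k x * (du k x t \<bullet> ddu j j x t + ddu j k x t \<bullet> du j x t) \<partial>lborel) = 0"
      by (rule integral_weighted_derivative_eq_0[where P' = K'' and e = "axis j 1" and f = "\<lambda>x. du k x t \<bullet> du j x t"
            and f' = "\<lambda>x h. du k x t \<bullet> Ddu j t x h + Ddu k t x h \<bullet> du j x t",
            OF K''(1) gaussian_decay_kernel_gradient[OF t(2)] dec d b, unfolded K''(2) Ddu_axis])+
  qed
  show "integrable lborel R"
    unfolding R_def
    by (intro Bochner_Integration.integrable_diff Bochner_Integration.integrable_sum integrable_mult_right 1 2)
  show "(\<integral>x. R x \<partial>lborel) = 0"
    unfolding R_def
    by (subst Bochner_Integration.integral_diff Bochner_Integration.integral_sum integral_mult_right_zero |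
        intro Bochner_Integration.integrable_diff Bochner_Integration.integrable_sum integrable_mult_right 1 2 | simp add: 1 2)+
qed

text \<open>The increment of the weighted energy is the integral of \<open>k \<tau>\<close>, which contains only
  increments of \<open>K\<close>, of \<open>F \<circ> u\<close> and of \<open>u\<close>. Each of them is at most \<open>|\<tau> - t|\<close> times a bound that is
  uniform near \<open>t\<close>, and has a pointwise derivative, so that dominated convergence applies.\<close>

lemma weighted_energy_derivative:
  assumes t: "0 < t" "t < s"
  shows "integrable lborel (weighted_energy_rate y s t)"
    and "((\<lambda>\<tau>. \<integral>x. inverse_heat_kernel y s x \<tau> * energy x \<tau> \<partial>lborel)
      has_real_derivative (\<integral>x. weighted_energy_rate y s t x \<partial>lborel)) (at t)"
proof -
  \<comment> \<open>Half of the distance to the nearer of 0 and \<open>s\<close>: the solution is not controlled at time 0, and the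
    kernel is singular at time \<open>s\<close>.\<close>
  define \<delta> where "\<delta> = min t (s - t) / 2"
  have \<delta>: "0 < \<delta>" "\<delta> \<le> t / 2" "\<delta> \<le> (s - t) / 2"
    using t by (auto simp: \<delta>_def)
  define I where "I = {t - \<delta>..t + \<delta>}"
  have near: "\<tau> \<in> I" "0 < \<tau>" "\<tau> < s" "\<bar>\<tau> - t\<bar> < (s - t) / 2" if "\<bar>\<tau> - t\<bar> < \<delta>" for \<tau>
  proof -
    have "\<tau> - t < \<delta>" "t - \<tau> < \<delta>" using that by (simp_all add: abs_less_iff)
    then show "\<tau> \<in> I" "0 < \<tau>" "\<tau> < s" using \<delta> t by (auto simp: I_def)
    show "\<bar>\<tau> - t\<bar> < (s - t) / 2" using that \<delta>(3) by (rule order.strict_trans2)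
  qed
  have I_pos: "0 < \<tau>" if "\<tau> \<in> I" for \<tau>
    using that \<delta> t by (auto simp: I_def)
  have tI: "t \<in> I" using \<delta> by (simp add: I_def)
  have a: "0 < t - \<delta>" using \<delta> t by simp
  note slab = bounded_slab[OF a, where b = "t + \<delta>", folded I_def]
  obtain Be where Be: "\<And>x \<tau>. \<tau> \<in> I \<Longrightarrow> \<bar>energy x \<tau>\<bar> \<le> Be"
    using bounded_slab_energy[OF a, where b = "t + \<delta>", folded I_def] by (fastforce simp: bounded_iff)
  obtain Bu where Bu: "\<And>x \<tau>. \<tau> \<in> I \<Longrightarrow> norm (time_deriv u x \<tau>) \<le> Bu"
    using slab(2) by (fastforce simp: bounded_iff)
  have "\<exists>B. \<forall>x. \<forall>\<tau>\<in>I. norm (du j x \<tau>) \<le> B" for j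
    using slab(3)[of j] by (fastforce simp: bounded_iff)
  then obtain Bp where Bp: "\<And>j x \<tau>. \<tau> \<in> I \<Longrightarrow> norm (du j x \<tau>) \<le> Bp j"
    by metis
  have "\<exists>B. \<forall>x. \<forall>\<tau>\<in>I. norm (ddu j j x \<tau>) \<le> B" for j
    using slab(4)[of j j] by (fastforce simp: bounded_iff)
  then obtain Bq where Bq: "\<And>j x \<tau>. \<tau> \<in> I \<Longrightarrow> norm (ddu j j x \<tau>) \<le> Bq j"
    by metis
  have "bounded ((\<lambda>z. (\<lambda>(x, t). G (u x t)) z \<bullet> (\<lambda>(x, t). time_deriv u x t) z) ` (UNIV \<times> I))"
    by (intro bounded_inner_comp slab bounded_slab_G[OF a, where b = "t + \<delta>", folded I_def])
  then obtain BF where BF: "\<And>x \<tau>. \<tau> \<in> I \<Longrightarrow> \<bar>G (u x \<tau>) \<bullet> time_deriv u x \<tau>\<bar> \<le> BF"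
    by (fastforce simp: bounded_iff)
  have convex: "convex I" by (simp add: I_def)
  have u_Lip: "norm (u x \<tau> - u x t) \<le> Bu * \<bar>\<tau> - t\<bar>" if "\<tau> \<in> I" for x \<tau>
  proof -
    have "norm (u x \<tau> - u x t) \<le> Bu * norm (\<tau> - t)"
    proof (rule differentiable_bound[OF convex])
      fix \<sigma> assume \<sigma>: "\<sigma> \<in> I"
      show "(u x has_derivative (\<lambda>h. h *\<^sub>R time_deriv u x \<sigma>)) (at \<sigma> within I)"
        using u_has_time_derivative[OF I_pos[OF \<sigma>], of x]
        by (auto simp: has_vector_derivative_def intro: has_derivative_at_withinI)
      show "onorm (\<lambda>h. h *\<^sub>R time_deriv u x \<sigma>) \<le> Bu"
        using Bu[OF \<sigma>, of x] by (intro onorm_le) (simp add: mult.commute[of Bu] mult_left_mono)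
    qed (use that tI in auto)
    then show ?thesis by simp
  qed
  have F_Lip: "\<bar>F (u x \<tau>) - F (u x t)\<bar> \<le> BF * \<bar>\<tau> - t\<bar>" if "\<tau> \<in> I" for x \<tau>
  proof -
    have "norm (F (u x \<tau>) - F (u x t)) \<le> BF * norm (\<tau> - t)"
      by (rule field_differentiable_bound[OF convex,
            where f = "\<lambda>\<tau>. F (u x \<tau>)" and f' = "\<lambda>\<sigma>. G (u x \<sigma>) \<bullet> time_deriv u x \<sigma>"])
        (use that tI BF in \<open>auto intro!: has_field_derivative_at_within Fu_has_time_derivative I_pos\<close>)
    then show ?thesis by simp
  qed
  obtain H where H: "gaussian_decay y H" "continuous_on UNIV H"
    "\<And>x \<tau>. \<bar>\<tau> - t\<bar> < (s - t) / 2 \<Longrightarrow>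
      \<bar>inverse_heat_kernel y s x \<tau> - inverse_heat_kernel y s x t\<bar> \<le> \<bar>\<tau> - t\<bar> * H x"
    by (rule inverse_heat_kernel_time_Lipschitz[OF t(2), of y]) blast
  let ?K = "\<lambda>\<tau> x. inverse_heat_kernel y s x \<tau>"
  let ?dK = "\<lambda>j x. kernel_gradient y s t j x"
  define k where "k \<tau> x = (?K \<tau> x - ?K t x) * energy x \<tau> + ?K t x * (F (u x \<tau>) - F (u x t))
      - \<epsilon> / 2 * (\<Sum>j\<in>UNIV. ?dK j x * ((u x \<tau> - u x t) \<bullet> (du j x \<tau> + du j x t))
          + ?K t x * ((u x \<tau> - u x t) \<bullet> (ddu j j x \<tau> + ddu j j x t)))" for \<tau> x
  define D where "D x = H x * Be + ?K t x * BF
      + \<epsilon> / 2 * (\<Sum>j\<in>UNIV. \<bar>?dK j x\<bar> * (Bu * (Bp j + Bp j)) + ?K t x * (Bu * (Bq j + Bq j)))" for x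
  have D_int: "integrable lborel D"
  proof -
    have 1: "integrable lborel H"
      by (intro gaussian_decay_integrable[OF H(1)] borel_measurable_continuous_onI H)
    have 2: "integrable lborel (?K t)"
      by (rule gaussian_decay_integrable[OF inverse_heat_kernel_decay[OF t(2)]]) measurable
    have 3: "integrable lborel (?dK j)" for j
      by (rule gaussian_decay_integrable[OF gaussian_decay_kernel_gradient[OF t(2)]]) measurable
    show ?thesis
      unfolding D_def
      by (intro Bochner_Integration.integrable_add Bochner_Integration.integrable_sum
          integrable_mult_right integrable_mult_left integrable_abs 1 2 3)
  qed
  \<comment> \<open>These functions have integral 0 and convert the increment of the integrand into \<open>k \<tau>\<close>.\<close>
  define V where "V j \<tau> x = ?dK j x * ((u x \<tau> - u x t) \<bullet> (du j x \<tau> + du j x t))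
      + ?K t x * ((u x \<tau> - u x t) \<bullet> (ddu j j x \<tau> + ddu j j x t)
        + (du j x \<tau> - du j x t) \<bullet> (du j x \<tau> + du j x t))" for j \<tau> x
  have V: "integrable lborel (V j \<tau>)" "(\<integral>x. V j \<tau> x \<partial>lborel) = 0" if "\<bar>\<tau> - t\<bar> < \<delta>" for j \<tau>
    unfolding V_def by (intro weighted_gradient_difference t near[OF that])+
  have k_eq: "k \<tau> x = ?K \<tau> x * energy x \<tau> - ?K t x * energy x t - \<epsilon> / 2 * (\<Sum>j\<in>UNIV. V j \<tau> x)" for \<tau> x
  proof -
    define S where "S = (\<Sum>j\<in>UNIV. ?dK j x * ((u x \<tau> - u x t) \<bullet> (du j x \<tau> + du j x t))
          + ?K t x * ((u x \<tau> - u x t) \<bullet> (ddu j j x \<tau> + ddu j j x t)))"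
    have V_sum: "(\<Sum>j\<in>UNIV. V j \<tau> x)
        = S + ?K t x * ((\<Sum>j\<in>UNIV. du j x \<tau> \<bullet> du j x \<tau>) - (\<Sum>j\<in>UNIV. du j x t \<bullet> du j x t))"
      unfolding V_def S_def sum_distrib_left sum.distrib[symmetric] sum_subtractf[symmetric]
      by (intro sum.cong refl) (simp add: inner_commute algebra_simps)
    show ?thesis
      unfolding k_def V_sum energy_def S_def[symmetric] by (simp add: field_simps)
  qed
  have k_int: "integrable lborel (k \<tau>)"
    "(\<integral>x. ?K \<tau> x * energy x \<tau> \<partial>lborel) - (\<integral>x. ?K t x * energy x t \<partial>lborel) = (\<integral>x. k \<tau> x \<partial>lborel)"
    if "\<bar>\<tau> - t\<bar> < \<delta>" for \<tau>
  proof -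
    note e = kernel_weighted_energy_integrable[OF near(2,3)[OF that]]
      kernel_weighted_energy_integrable[OF t]
    have S: "integrable lborel (\<lambda>x. \<epsilon> / 2 * (\<Sum>j\<in>UNIV. V j \<tau> x))"
      by (intro integrable_mult_right Bochner_Integration.integrable_sum V that)
    show "integrable lborel (k \<tau>)"
      unfolding k_eq[abs_def] by (intro Bochner_Integration.integrable_diff e S)
    show "(\<integral>x. ?K \<tau> x * energy x \<tau> \<partial>lborel) - (\<integral>x. ?K t x * energy x t \<partial>lborel) = (\<integral>x. k \<tau> x \<partial>lborel)"
      unfolding k_eq using e S V[OF that] by simp
  qed
  have bound: "\<bar>k \<tau> x\<bar> \<le> \<bar>\<tau> - t\<bar> * D x" if "\<bar>\<tau> - t\<bar> < \<delta>" for \<tau> x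
  proof -
    note \<tau> = near[OF that]
    define h where "h = \<bar>\<tau> - t\<bar>"
    have h: "0 \<le> h" by (simp add: h_def)
    have Hx: "\<bar>?K \<tau> x - ?K t x\<bar> \<le> h * H x"
      unfolding h_def by (rule H(3)[OF \<tau>(4)])
    have "\<bar>(?K \<tau> x - ?K t x) * energy x \<tau>\<bar> \<le> (h * H x) * Be"
      unfolding abs_mult using Hx Be[OF \<tau>(1), of x] by (intro mult_mono) auto
    moreover have "\<bar>?K t x * (F (u x \<tau>) - F (u x t))\<bar> \<le> ?K t x * (BF * h)"
      unfolding abs_mult h_def abs_of_nonneg[OF inverse_heat_kernel_nonneg]
      by (intro mult_left_mono F_Lip \<tau> inverse_heat_kernel_nonneg)
    moreover have "\<bar>\<epsilon> / 2 * (\<Sum>j\<in>UNIV. ?dK j x * ((u x \<tau> - u x t) \<bullet> (du j x \<tau> + du j x t))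
          + ?K t x * ((u x \<tau> - u x t) \<bullet> (ddu j j x \<tau> + ddu j j x t)))\<bar>
        \<le> \<epsilon> / 2 * (\<Sum>j\<in>UNIV. \<bar>?dK j x\<bar> * ((Bu * h) * (Bp j + Bp j)) + ?K t x * ((Bu * h) * (Bq j + Bq j)))"
    proof -
      have inner_le: "\<bar>(u x \<tau> - u x t) \<bullet> (f x \<tau> + f x t)\<bar> \<le> (Bu * h) * (B + B)"
        if "\<And>\<sigma>. \<sigma> \<in> I \<Longrightarrow> norm (f x \<sigma>) \<le> B" for f B
      proof -
        have "norm (f x \<tau> + f x t) \<le> B + B"
          by (intro norm_triangle_mono that \<tau> tI)
        then have "norm (u x \<tau> - u x t) * norm (f x \<tau> + f x t) \<le> (Bu * h) * (B + B)"
          using u_Lip[OF \<tau>(1), of x] order_trans[OF norm_ge_zero u_Lip[OF \<tau>(1), of x]] unfolding h_def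
          by (intro mult_mono) auto
        then show ?thesis
          by (rule order_trans[OF Cauchy_Schwarz_ineq2])
      qed
      have "\<bar>?dK j x * ((u x \<tau> - u x t) \<bullet> (du j x \<tau> + du j x t))
          + ?K t x * ((u x \<tau> - u x t) \<bullet> (ddu j j x \<tau> + ddu j j x t))\<bar>
        \<le> \<bar>?dK j x\<bar> * ((Bu * h) * (Bp j + Bp j)) + ?K t x * ((Bu * h) * (Bq j + Bq j))" for j
        by (intro order_trans[OF abs_triangle_ineq] add_mono)
          (auto simp only: abs_mult abs_of_nonneg[OF inverse_heat_kernel_nonneg]
            intro!: mult_left_mono inner_le Bp Bq inverse_heat_kernel_nonneg abs_ge_zero)
      then show ?thesis
        using \<epsilon> unfolding abs_mult by (intro mult_mono order_trans[OF sum_abs] sum_mono) auto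
    qed
    ultimately have "\<bar>k \<tau> x\<bar> \<le> (h * H x) * Be + ?K t x * (BF * h)
        + \<epsilon> / 2 * (\<Sum>j\<in>UNIV. \<bar>?dK j x\<bar> * ((Bu * h) * (Bp j + Bp j)) + ?K t x * ((Bu * h) * (Bq j + Bq j)))"
      unfolding k_def by linarith
    also have "\<dots> = h * D x"
      by (simp add: D_def sum_distrib_left distrib_left mult_ac)
    finally show ?thesis by (simp add: h_def)
  qed
  have lim: "((\<lambda>\<tau>. k \<tau> x / (\<tau> - t)) \<longlongrightarrow> weighted_energy_rate y s t x) (at t)" for x
  proof -
    have K: "((\<lambda>\<tau>. (?K \<tau> x - ?K t x) / (\<tau> - t)) \<longlongrightarrow>
        ((real CARD('d) - 1) / (2 * (s - t)) - (norm (x - y))\<^sup>2 / (4 * (s - t)\<^sup>2)) * ?K t x) (at t)"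
      using inverse_heat_kernel_time_derivative[OF t(2), of y x] by (simp add: has_field_derivative_iff)
    have F: "((\<lambda>\<tau>. (F (u x \<tau>) - F (u x t)) / (\<tau> - t)) \<longlongrightarrow> G (u x t) \<bullet> time_deriv u x t) (at t)"
      using Fu_has_time_derivative[OF t(1), of x] by (simp add: has_field_derivative_iff)
    have U: "((\<lambda>\<tau>. (u x \<tau> - u x t) /\<^sub>R (\<tau> - t)) \<longlongrightarrow> time_deriv u x t) (at t)"
    proof -
      let ?v = "time_deriv u x t"
      have "((\<lambda>\<tau>. norm (u x \<tau> - u x t - (\<tau> - t) *\<^sub>R ?v) / norm (\<tau> - t)) \<longlongrightarrow> 0) (at t)"
        using u_has_time_derivative[OF t(1), of x] by (simp add: has_vector_derivative_def has_derivative_iff_norm)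
      moreover have "\<forall>\<^sub>F \<tau> in at t. norm (u x \<tau> - u x t - (\<tau> - t) *\<^sub>R ?v) / norm (\<tau> - t)
          = norm ((u x \<tau> - u x t) /\<^sub>R (\<tau> - t) - ?v)"
        using eventually_neq_at_within[of t t UNIV]
      proof eventually_elim
        case (elim \<tau>)
        then have "(u x \<tau> - u x t) /\<^sub>R (\<tau> - t) - ?v = (u x \<tau> - u x t - (\<tau> - t) *\<^sub>R ?v) /\<^sub>R (\<tau> - t)"
          by (simp add: scaleR_diff_right)
        then show ?case by (simp add: divide_inverse mult.commute)
      qed
      ultimately have "((\<lambda>\<tau>. norm ((u x \<tau> - u x t) /\<^sub>R (\<tau> - t) - ?v)) \<longlongrightarrow> 0) (at t)"
        by (rule Lim_transform_eventually)
      then show ?thesis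
        by (rule Lim_null[THEN iffD2, OF tendsto_norm_zero_cancel])
    qed
    have "((\<lambda>\<tau>. (?K \<tau> x - ?K t x) / (\<tau> - t) * energy x \<tau> + ?K t x * ((F (u x \<tau>) - F (u x t)) / (\<tau> - t))
      - \<epsilon> / 2 * (\<Sum>j\<in>UNIV. ?dK j x * (((u x \<tau> - u x t) /\<^sub>R (\<tau> - t)) \<bullet> (du j x \<tau> + du j x t))
          + ?K t x * (((u x \<tau> - u x t) /\<^sub>R (\<tau> - t)) \<bullet> (ddu j j x \<tau> + ddu j j x t))))
      \<longlongrightarrow> ((real CARD('d) - 1) / (2 * (s - t)) - (norm (x - y))\<^sup>2 / (4 * (s - t)\<^sup>2)) * ?K t x * energy x t
        + ?K t x * (G (u x t) \<bullet> time_deriv u x t)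
        - \<epsilon> / 2 * (\<Sum>j\<in>UNIV. ?dK j x * (time_deriv u x t \<bullet> (du j x t + du j x t))
          + ?K t x * (time_deriv u x t \<bullet> (ddu j j x t + ddu j j x t)))) (at t)"
      by (intro tendsto_intros K F U tendsto_in_time[OF _ t(1)] energy_continuous jointly_continuous)
    moreover have "(?K \<tau> x - ?K t x) / (\<tau> - t) * energy x \<tau> + ?K t x * ((F (u x \<tau>) - F (u x t)) / (\<tau> - t))
      - \<epsilon> / 2 * (\<Sum>j\<in>UNIV. ?dK j x * (((u x \<tau> - u x t) /\<^sub>R (\<tau> - t)) \<bullet> (du j x \<tau> + du j x t))
          + ?K t x * (((u x \<tau> - u x t) /\<^sub>R (\<tau> - t)) \<bullet> (ddu j j x \<tau> + ddu j j x t)))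
      = k \<tau> x / (\<tau> - t)" for \<tau>
      unfolding k_def divide_inverse[of _ "\<tau> - t"] left_diff_distrib[of _ _ "inverse (\<tau> - t)"]
        distrib_right[of _ _ "inverse (\<tau> - t)"]
      by (simp add: sum_distrib_right sum_distrib_left algebra_simps)
    moreover have "\<epsilon> / 2 * (\<Sum>j\<in>UNIV. ?dK j x * (time_deriv u x t \<bullet> (du j x t + du j x t))
          + ?K t x * (time_deriv u x t \<bullet> (ddu j j x t + ddu j j x t)))
      = \<epsilon> * (\<Sum>j\<in>UNIV. ?dK j x * (time_deriv u x t \<bullet> du j x t) + ?K t x * (time_deriv u x t \<bullet> ddu j j x t))"
    proof -
      have "v \<bullet> (w + w) = 2 * (v \<bullet> w)" for v w :: "real ^ 'n"
        by (simp only: inner_add_right mult_2)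
      then show ?thesis
        unfolding sum_distrib_left by (intro sum.cong refl) (simp only:, simp add: algebra_simps)
    qed
    ultimately show ?thesis
      unfolding weighted_energy_rate_def by (simp only:)
  qed
  have meas: "k \<tau> \<in> borel_measurable lborel" if "\<bar>\<tau> - t\<bar> < \<delta>" for \<tau>
    using k_int(1)[OF that] by (rule borel_measurable_integrable)
  show "integrable lborel (weighted_energy_rate y s t)"
    by (rule has_real_derivative_integral_dominated(1)[OF \<delta>(1) D_int k_int(2) meas bound lim])
  show "((\<lambda>\<tau>. \<integral>x. inverse_heat_kernel y s x \<tau> * energy x \<tau> \<partial>lborel)
      has_real_derivative (\<integral>x. weighted_energy_rate y s t x \<partial>lborel)) (at t)"
    by (rule has_real_derivative_integral_dominated(2)[OF \<delta>(1) D_int k_int(2) meas bound lim])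
qed

text \<open>The integral of \<open>R\<close> vanishes by the stress identity. After adding \<open>R\<close>, the integrand is
  pointwise equal to the kernel times
  \<open>\<xi> / (2 (s - t)) - \<epsilon> |\<partial>\<^sub>t u - (a \<bullet> \<nabla>)u|\<^sup>2\<close> with \<open>a = (x - y) / (2 (s - t))\<close>, where \<open>\<xi>\<close> is the
  discrepancy density. The exponent \<open>(d - 1) / 2\<close> of the kernel, instead of \<open>d / 2\<close>, leaves the term
  \<open>- e / (2 (s - t))\<close> that turns \<open>\<epsilon> |\<nabla>u|\<^sup>2\<close> into the discrepancy.\<close>

theorem weighted_energy_monotonicity:
  assumes t: "0 < t" "t < s"
  shows "(\<integral>x. weighted_energy_rate y s t x \<partial>lborel)
    \<le> 1 / (2 * (s - t)) * (\<integral>x. inverse_heat_kernel y s x t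
        * (\<epsilon> / 2 * (\<Sum>j\<in>UNIV. du j x t \<bullet> du j x t) - F (u x t)) \<partial>lborel)"
proof -
  define R where "R x = (\<Sum>k\<in>UNIV. kernel_hessian y s t k k x * energy x t
        + kernel_gradient y s t k x * (\<epsilon> * (\<Sum>j\<in>UNIV. ddu k j x t \<bullet> du j x t) + G (u x t) \<bullet> du k x t))
      - \<epsilon> * (\<Sum>j\<in>UNIV. \<Sum>k\<in>UNIV. kernel_hessian y s t j k x * (du k x t \<bullet> du j x t)
        + kernel_gradient y s t k x * (du k x t \<bullet> ddu j j x t + ddu j k x t \<bullet> du j x t))" for x
  let ?K = "\<lambda>x. inverse_heat_kernel y s x t"
  let ?\<xi> = "\<lambda>x. \<epsilon> / 2 * (\<Sum>j\<in>UNIV. du j x t \<bullet> du j x t) - F (u x t)"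
  have R: "integrable lborel R" "(\<integral>x. R x \<partial>lborel) = 0"
    unfolding R_def by (rule stress_identity[OF t])+
  have \<xi>: "integrable lborel (\<lambda>x. ?K x * ?\<xi> x)"
    by (rule kernel_weighted_discrepancy_integrable[OF t])
  have le: "weighted_energy_rate y s t x + R x \<le> 1 / (2 * (s - t)) * (?K x * ?\<xi> x)" for x
  proof -
    define b where "b = 1 / (2 * (s - t))"
    define a where "a k = (x - y) $ k / (2 * (s - t))" for k
    define A where "A = (\<Sum>j\<in>UNIV. a j * a j)"
    define N where "N = (time_deriv u x t - (\<Sum>k\<in>UNIV. a k *\<^sub>R du k x t)) \<bullet> (time_deriv u x t - (\<Sum>k\<in>UNIV. a k *\<^sub>R du k x t))"
    have N: "0 \<le> \<epsilon> * N" using \<epsilon> by (simp add: N_def)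
    have A: "(norm (x - y))\<^sup>2 / (4 * (s - t)\<^sup>2) = A"
    proof -
      have "4 * (s - t)\<^sup>2 = (2 * (s - t)) * (2 * (s - t))"
        by (simp add: power2_eq_square algebra_simps)
      then show ?thesis
        by (simp only: A_def a_def power2_norm_eq_inner inner_vec_def inner_real_def
            sum_divide_distrib times_divide_times_eq)
    qed
    have d: "(real CARD('d) - 1) / (2 * (s - t)) = real CARD('d) * b - b"
      by (simp add: b_def diff_divide_distrib)
    have grad: "kernel_gradient y s t k x = - a k * ?K x" for k
      by (simp add: kernel_gradient_def a_def)
    have hess: "kernel_hessian y s t j k x = (a j * a k - (if j = k then b else 0)) * ?K x" for j k
      by (simp only: kernel_hessian_def a_def b_def)
    have 1: "weighted_energy_rate y s t x = ?K x * ((real CARD('d) * b - A) * energy x t - b * energy x t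
        + G (u x t) \<bullet> time_deriv u x t
        - \<epsilon> * (\<Sum>j\<in>UNIV. - a j * (time_deriv u x t \<bullet> du j x t) + time_deriv u x t \<bullet> ddu j j x t))"
      unfolding weighted_energy_rate_def A d grad by (simp add: sum_distrib_left algebra_simps)
    have 2: "R x = ?K x * ((\<Sum>k\<in>UNIV. (a k * a k - b) * energy x t
          - a k * (\<epsilon> * (\<Sum>j\<in>UNIV. ddu k j x t \<bullet> du j x t) + G (u x t) \<bullet> du k x t))
        - \<epsilon> * (\<Sum>j\<in>UNIV. \<Sum>k\<in>UNIV. (a j * a k - (if j = k then b else 0)) * (du k x t \<bullet> du j x t)
          - a k * (ddu j k x t \<bullet> du j x t + du k x t \<bullet> ddu j j x t)))"
    proof -
      have "(\<Sum>k\<in>UNIV. kernel_hessian y s t k k x * energy x t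
          + kernel_gradient y s t k x * (\<epsilon> * (\<Sum>j\<in>UNIV. ddu k j x t \<bullet> du j x t) + G (u x t) \<bullet> du k x t))
        = ?K x * (\<Sum>k\<in>UNIV. (a k * a k - b) * energy x t
          - a k * (\<epsilon> * (\<Sum>j\<in>UNIV. ddu k j x t \<bullet> du j x t) + G (u x t) \<bullet> du k x t))"
        unfolding sum_distrib_left[of "?K x"] by (intro sum.cong refl) (simp add: grad hess algebra_simps)
      moreover have "(\<Sum>j\<in>UNIV. \<Sum>k\<in>UNIV. kernel_hessian y s t j k x * (du k x t \<bullet> du j x t)
          + kernel_gradient y s t k x * (du k x t \<bullet> ddu j j x t + ddu j k x t \<bullet> du j x t))
        = ?K x * (\<Sum>j\<in>UNIV. \<Sum>k\<in>UNIV. (a j * a k - (if j = k then b else 0)) * (du k x t \<bullet> du j x t)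
          - a k * (ddu j k x t \<bullet> du j x t + du k x t \<bullet> ddu j j x t))"
        unfolding sum_distrib_left[of "?K x"] grad hess
        by (intro sum.cong refl) (simp only: algebra_simps)
      ultimately show ?thesis
        unfolding R_def by (simp only: right_diff_distrib mult.left_commute)
    qed
    have "weighted_energy_rate y s t x + R x = ?K x * (\<epsilon> * b * (\<Sum>j\<in>UNIV. du j x t \<bullet> du j x t) - \<epsilon> * N - b * energy x t)"
      using monotonicity_pointwise_algebra[where du = "\<lambda>j. du j x t" and ddu = "\<lambda>j k. ddu j k x t"
          and a = a and b = b, OF ddu_commute[OF t(1)] flow[OF t(1)] energy_def]
      unfolding 1 2 distrib_left[symmetric] A_def[symmetric] N_def[symmetric]
      by (intro arg_cong[where f = "\<lambda>z. ?K x * z"]) linarith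
    also have "\<dots> = ?K x * (b * ?\<xi> x - \<epsilon> * N)"
      by (simp add: energy_def algebra_simps)
    also have "\<dots> \<le> ?K x * (b * ?\<xi> x)"
      using N by (intro mult_left_mono inverse_heat_kernel_nonneg) simp
    finally show ?thesis
      by (simp only: b_def mult.left_commute)
  qed
  have "(\<integral>x. weighted_energy_rate y s t x \<partial>lborel) = (\<integral>x. weighted_energy_rate y s t x + R x \<partial>lborel)"
    using R weighted_energy_derivative(1)[OF t, of y] by simp
  also have "\<dots> \<le> (\<integral>x. 1 / (2 * (s - t)) * (?K x * ?\<xi> x) \<partial>lborel)"
    using R(1) weighted_energy_derivative(1)[OF t, of y] \<xi> le
    by (intro integral_mono Bochner_Integration.integrable_add integrable_mult_right)
  finally show ?thesis by simp
qed

end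

section \<open>The Allen--Cahn system\<close>

lemma double_well_nonneg: "0 \<le> double_well u"
  by (simp add: double_well_def)

lemma double_well_has_derivative: "(double_well has_real_derivative deriv double_well u) (at u)"
proof -
  have "double_well field_differentiable (at u)"
    unfolding double_well_def[abs_def] by (intro derivative_intros)
  then show ?thesis by (rule field_differentiable_derivI)
qed

lemma phi_has_derivative: "(phi has_real_derivative sqrt (2 * double_well u)) (at u)"
proof -
  define a b where "a = min 0 u - 1" and "b = max 0 u + 1"
  have ab: "a \<le> 0" "0 \<le> b" "a < u" "u < b" by (auto simp: a_def b_def)
  have "continuous_on {a..b} (\<lambda>s. sqrt (2 * double_well s))"
    unfolding double_well_def by (intro continuous_intros)
  then have "((\<lambda>u. LBINT s=ereal 0..ereal u. sqrt (2 * double_well s))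
      has_vector_derivative sqrt (2 * double_well u)) (at u within {a..b})"
    using ab by (intro interval_integral_FTC2) (auto simp flip: zero_ereal_def)
  then have "(phi has_real_derivative sqrt (2 * double_well u)) (at u within {a..b})"
    by (simp add: phi_def[abs_def] has_real_derivative_iff_has_vector_derivative)
  moreover have "at u within {a..b} = at u"
    using ab by (intro at_within_interior) (simp add: interior_atLeastAtMost_real)
  ultimately show ?thesis by simp
qed

definition F_gradient :: "real \<Rightarrow> real \<Rightarrow> real ^ 'n \<Rightarrow> real ^ 'n" where
  "F_gradient \<alpha> \<epsilon> v = (\<chi> i. 1 / \<epsilon> * deriv double_well (v $ i)
     - 1 / \<epsilon> powr \<alpha> * sqrt (2 * double_well (v $ i)) * (sigma - (\<Sum>j\<in>UNIV. phi (v $ j))))"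

lemma F_pot_has_derivative:
  fixes v :: "real ^ 'n"
  shows "(F_pot \<alpha> \<epsilon> has_derivative (\<lambda>h. F_gradient \<alpha> \<epsilon> v \<bullet> h)) (at v)"
proof -
  have nth: "((\<lambda>v. f (v $ i)) has_derivative (\<lambda>h. f' * h $ i)) (at v)"
    if "(f has_real_derivative f') (at (v $ i))" for f f' i
    using has_derivative_compose[OF bounded_linear.has_derivative[OF bounded_linear_vec_nth has_derivative_ident]
        that[unfolded has_field_derivative_def]] .
  define S where "S = sigma - (\<Sum>j\<in>UNIV. phi (v $ j))"
  have "(F_pot \<alpha> \<epsilon> has_derivative (\<lambda>h. 1 / \<epsilon> * (\<Sum>i\<in>UNIV. deriv double_well (v $ i) * h $ i)
      + 1 / (2 * \<epsilon> powr \<alpha>) * (of_nat 2 * (0 - (\<Sum>i\<in>UNIV. sqrt (2 * double_well (v $ i)) * h $ i)) * S ^ (2 - 1)))) (at v)"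
    unfolding F_pot_def[abs_def] S_def
    by (intro has_derivative_add has_derivative_mult_right has_derivative_sum has_derivative_power
        has_derivative_diff has_derivative_const nth double_well_has_derivative phi_has_derivative)
  then show ?thesis
  proof (rule has_derivative_eq_rhs, intro ext)
    fix h :: "real ^ 'n"
    have "F_gradient \<alpha> \<epsilon> v \<bullet> h = (\<Sum>i\<in>UNIV. 1 / \<epsilon> * (deriv double_well (v $ i) * h $ i)
        - 1 / \<epsilon> powr \<alpha> * S * (sqrt (2 * double_well (v $ i)) * h $ i))"
      unfolding inner_vec_def F_gradient_def S_def[symmetric] by (intro sum.cong refl) (simp add: algebra_simps)
    also have "\<dots> = 1 / \<epsilon> * (\<Sum>i\<in>UNIV. deriv double_well (v $ i) * h $ i)
      + 1 / (2 * \<epsilon> powr \<alpha>) * (of_nat 2 * (0 - (\<Sum>i\<in>UNIV. sqrt (2 * double_well (v $ i)) * h $ i)) * S ^ (2 - 1))"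
      unfolding sum_subtractf sum_distrib_left[symmetric] by (simp add: field_simps)
    finally show "1 / \<epsilon> * (\<Sum>i\<in>UNIV. deriv double_well (v $ i) * h $ i)
      + 1 / (2 * \<epsilon> powr \<alpha>) * (of_nat 2 * (0 - (\<Sum>i\<in>UNIV. sqrt (2 * double_well (v $ i)) * h $ i)) * S ^ (2 - 1))
      = F_gradient \<alpha> \<epsilon> v \<bullet> h" by simp
  qed
qed

lemma F_pot_nonneg: "0 < \<epsilon> \<Longrightarrow> 0 \<le> F_pot \<alpha> \<epsilon> v"
  unfolding F_pot_def by (intro add_nonneg_nonneg mult_nonneg_nonneg sum_nonneg double_well_nonneg) auto

text \<open>Since the derivative of \<open>phi\<close> is \<open>sqrt (2 W)\<close>, the reaction term of the system is exactly
  the negative gradient of the potential.\<close>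

lemma Allen_Cahn_gradient_flow:
  assumes "0 < \<epsilon>" "Allen_Cahn_solution \<alpha> \<epsilon> u"
  shows "gradient_flow u \<epsilon> (F_pot \<alpha> \<epsilon>) (F_gradient \<alpha> \<epsilon>)"
proof -
  interpret periodic_C21 u
    using assms by unfold_locales (auto simp: Allen_Cahn_solution_def)
  show ?thesis
  proof unfold_locales
    fix x and t :: real assume "0 < t"
    then show "\<epsilon> *\<^sub>R time_deriv u x t = \<epsilon> *\<^sub>R (\<Sum>j\<in>UNIV. ddu j j x t) - F_gradient \<alpha> \<epsilon> (u x t)"
      using assms(2) unfolding vec_eq_iff
      by (auto simp: Allen_Cahn_solution_def Laplacian_def F_gradient_def ddu_def du_eta)
  qed (use assms F_pot_has_derivative in auto)
qed

lemma norm_jacobian: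
  fixes u :: "real ^ 'd \<Rightarrow> real \<Rightarrow> real ^ 'n"
  assumes "periodic_C21 u"
  shows "(norm (jacobian (\<lambda>z. u z t) (at x)))\<^sup>2
    = (\<Sum>j\<in>UNIV. periodic_C21.du u j x t \<bullet> periodic_C21.du u j x t)"
proof -
  have entry: "jacobian (\<lambda>z. u z t) (at x) $ i $ j = periodic_C21.du u j x t $ i" for i j
    by (simp add: jacobian_def matrix_def periodic_C21.du_def[OF assms] partial_def)
  show ?thesis
    unfolding power2_norm_eq_inner inner_vec_def entry inner_real_def by (rule sum.swap)
qed

theorem lemma2:
  fixes u :: "real ^ 'd \<Rightarrow> real \<Rightarrow> real ^ 'n"
    and y :: "real ^ 'd"
    and \<alpha> \<epsilon> s t :: real
  assumes "0 < \<alpha>" and "\<alpha> < 1"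
    and "0 < \<epsilon>" and "\<epsilon> \<le> 1"
    and "Allen_Cahn_solution \<alpha> \<epsilon> u"
    and "0 < s"
    and "0 < t" and "t < s"
  shows "\<exists>D. ((\<lambda>\<tau>. \<integral>x. inverse_heat_kernel y s x \<tau> \<partial>energy_measure \<alpha> \<epsilon> u \<tau>)
               has_real_derivative D) (at t)
       \<and> D \<le> 1 / (2 * (s - t)) *
               signed_integral (discrepancy_density \<alpha> \<epsilon> u t) (\<lambda>x. inverse_heat_kernel y s x t)
       \<and> D + 1 / (2 * (s - t)) *
               (\<integral>x. inverse_heat_kernel y s x t \<partial>neg_part (discrepancy_density \<alpha> \<epsilon> u t))
         \<le> 1 / (2 * (s - t)) *
               (\<integral>x. inverse_heat_kernel y s x t \<partial>pos_part (discrepancy_density \<alpha> \<epsilon> u t))"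
proof -
  interpret gradient_flow u \<epsilon> "F_pot \<alpha> \<epsilon>" "F_gradient \<alpha> \<epsilon>"
    by (rule Allen_Cahn_gradient_flow[OF assms(3,5)])
  let ?K = "\<lambda>x. inverse_heat_kernel y s x t"
  let ?\<xi> = "discrepancy_density \<alpha> \<epsilon> u t"
  define c where "c = 1 / (2 * (s - t))"
  define D where "D = (\<integral>x. weighted_energy_rate y s t x \<partial>lborel)"
  note jacobian = norm_jacobian[OF periodic_C21_axioms]
  have energy: "energy_density \<alpha> \<epsilon> u \<tau> x = energy x \<tau>" for \<tau> x
    by (simp add: energy_density_def energy_def jacobian)
  have \<xi>: "?\<xi> x = \<epsilon> / 2 * (\<Sum>j\<in>UNIV. du j x t \<bullet> du j x t) - F_pot \<alpha> \<epsilon> (u x t)" for x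
    by (simp add: discrepancy_density_def jacobian)
  have integral_energy: "(\<integral>x. inverse_heat_kernel y s x \<tau> \<partial>energy_measure \<alpha> \<epsilon> u \<tau>)
      = (\<integral>x. inverse_heat_kernel y s x \<tau> * energy x \<tau> \<partial>lborel)" if "0 < \<tau>" for \<tau>
  proof -
    have [measurable]: "(\<lambda>x. energy x \<tau>) \<in> borel_measurable borel"
      by (intro borel_measurable_continuous_onI continuous_in_space[OF energy_continuous that])
    have "0 \<le> energy x \<tau>" for x
      unfolding energy_def using assms(3) F_pot_nonneg[OF assms(3)]
      by (intro add_nonneg_nonneg mult_nonneg_nonneg sum_nonneg) auto
    then show ?thesis
      unfolding energy_measure_def energy by (subst integral_density) (auto simp: mult.commute)
  qed
  have "((\<lambda>\<tau>. \<integral>x. inverse_heat_kernel y s x \<tau> \<partial>energy_measure \<alpha> \<epsilon> u \<tau>) has_real_derivative D) (at t)"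
    unfolding D_def using weighted_energy_derivative(2)[OF assms(7,8), of y]
    by (rule has_field_derivative_transform_within_open[of _ _ _ "{0<..}"])
      (use assms(7) integral_energy in auto)
  moreover have le: "D \<le> c * signed_integral ?\<xi> ?K"
    using weighted_energy_monotonicity[OF assms(7,8), of y]
    unfolding D_def c_def signed_integral_def \<xi> .
  moreover have "D + c * (\<integral>x. ?K x \<partial>neg_part ?\<xi>) \<le> c * (\<integral>x. ?K x \<partial>pos_part ?\<xi>)"
  proof -
    have int: "integrable lborel (\<lambda>x. ?K x * ?\<xi> x)"
      unfolding \<xi> by (rule kernel_weighted_discrepancy_integrable[OF assms(7,8)])
    have "continuous_on UNIV ?\<xi>"
      unfolding \<xi>[abs_def]
      using continuous_in_space[OF Fu_continuous assms(7)] continuous_in_space[OF jointly_continuous(3) assms(7)]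
      by (intro continuous_intros)
    then have [measurable]: "?\<xi> \<in> borel_measurable borel"
      by (rule borel_measurable_continuous_onI)
    have pos: "(\<integral>x. ?K x \<partial>pos_part ?\<xi>) = (\<integral>x. max 0 (?K x * ?\<xi> x) \<partial>lborel)"
      unfolding pos_part_def
      by (subst integral_density)
        (auto intro!: Bochner_Integration.integral_cong
          simp: max_mult_distrib_left mult.commute[of "max _ _"] inverse_heat_kernel_nonneg)
    have neg: "(\<integral>x. ?K x \<partial>neg_part ?\<xi>) = (\<integral>x. max 0 (- (?K x * ?\<xi> x)) \<partial>lborel)"
      unfolding neg_part_def
      by (subst integral_density)
        (auto intro!: Bochner_Integration.integral_cong
          simp: max_mult_distrib_left mult.commute[of "max _ _"] inverse_heat_kernel_nonneg)
    have "(\<integral>x. ?K x \<partial>pos_part ?\<xi>) - (\<integral>x. ?K x \<partial>neg_part ?\<xi>)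
        = (\<integral>x. max 0 (?K x * ?\<xi> x) - max 0 (- (?K x * ?\<xi> x)) \<partial>lborel)"
      unfolding pos neg using int by (subst Bochner_Integration.integral_diff) auto
    also have "\<dots> = signed_integral ?\<xi> ?K"
      unfolding signed_integral_def by (intro Bochner_Integration.integral_cong) auto
    finally show ?thesis
      using le by (simp add: algebra_simps flip: right_diff_distrib)
  qed
  ultimately show ?thesis
    unfolding c_def by blast
qed

end
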